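(* Let $f,g,F=f+g$ be as in the context, and let $\{(x^k,y^k)\}_{k\in\mathbb N}$ be a sequence generated by the line-search based variable metric inexact proximal gradient (VMiPG) method described in the context. Suppose that the sequence $\{x^k\}_{k\in\mathbb N}$ is bounded, that there is a constant $\overline\mu>0$ such that $\|\mathcal G_k\|\le\overline\mu$ for all $k\in\mathbb N$, and that for a certain $\gamma\in(0,1/\overline\mu]$ the function $\Phi_\gamma$ is a KL function. Then $$\sum_{k=0}^{\infty}\|x^{k+1}-x^k\|<\infty,$$ and consequently $\{x^k\}_{k\in\mathbb N}$ converges to a point $\overline x\in S^*$.
   Context: **Problem.** $\mathbb X$ is a finite-dimensional real vector space with inner product $\langle\cdot,\cdot\rangle$ and induced norm $\|\cdot\|$; $\overline{\mathbb R}=(-\infty,\infty]$; $\mathcal I$ is the identity on $\mathbb X$; for a linear operator, $\|\cdot\|$ is the spectral norm; $\mathcal Q\succeq\mathcal Q'$ means that $\mathcal Q-\mathcal Q'$ is self-adjoint and positive semidefinite. The functions $f,g:\mathbb X\to\overline{\mathbb R}$ are proper, $F:=f+g$, and: (i) $g$ is lower semicontinuous (lsc), convex, and continuous relative to its domain ${\rm dom}\,g$; (ii) $f$ is lsc and twice continuously differentiable on an open set $\mathcal O\supset{\rm cl}({\rm dom}\,g)$; (iii) $\inf_{x\in\mathbb X}F(x)>-\infty$. The set of stationary points is $S^*:=\{x\in\mathbb X: 0\in\nabla f(x)+\partial g(x)\}$. **The VMiPG method.** Parameters: $\underline\mu>0$, $\beta\in(0,1)$, $\sigma\in(0,\frac12\min\{1,\underline\mu\})$,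 a bounded sequence $\{\varepsilon_k\}\subset(0,\infty)$, and $x^0\in{\rm dom}\,g$. It is assumed that there is $\overline k\in\mathbb N$ with $\varepsilon_k\in(0,\underline\mu/10]$ for all $k\ge\overline k$. For $k=0,1,2,\dots$: 1. Select a self-adjoint linear operator $\mathcal G_k:\mathbb X\to\mathbb X$ with $\mathcal G_k\succeq\underline\mu\mathcal I$. Let $\Theta_k(x):=f(x^k)+\langle\nabla f(x^k),x-x^k\rangle+\frac12\langle x-x^k,\mathcal G_k(x-x^k)\rangle+g(x)$ and let $\overline x^k$ be its unique minimizer. Choose $y^k$ with $\Theta_k(y^k)<\Theta_k(x^k)$ and $\Theta_k(y^k)-\Theta_k(\overline x^k)\le\varsigma_k:=\varepsilon_k\|y^k-x^k\|^2$. 2. Put $d^k:=y^k-x^k$ and let $m_k$ be the smallest nonnegative integer $m$ with $F(x^k)-F(x^k+\beta^m d^k)\ge\sigma\beta^m\|d^k\|^2$. 3. Put $\alpha_k:=\beta^{m_k}$ and $x^{k+1}:=y^k$ if $F(y^k)<F(x^k+\alpha_kd^k)$, and $x^{k+1}:=x^k+\alpha_kd^k$ otherwise. **The potential function.** When $\{x^k\}$ and $\{\|\mathcal G_k\|\}$ are bounded, $\{y^k\}$ is bounded too, and there is a compact convex set $\Gamma$ with $\{x^k\}\cup\{y^k\}\subset\Gamma\subset\mathcal O$; fix such a $\Gamma$ and let $L_f>0$ be a Lipschitz constant of $\nabla f$ on $\Gamma$. For $\gamma>0$ the forward-backward envelope of $F$ is $$F_\gamma(x):=\inf_{y\in\mathbb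 X}\Big\{g(y)+\langle\nabla f(x),y-x\rangle+\tfrac1{2\gamma}\|y-x\|^2+f(x)\Big\}\ \text{ if }x\in{\rm cl}({\rm dom}\,g),\qquad F_\gamma(x):=\infty\ \text{ otherwise,}$$ and $$\Phi_\gamma(z):=F_\gamma(x)+\tfrac{L_f}{2}\|y-x\|^2+t^2,\qquad z=(x,y,t)\in\mathbb Z:=\mathbb X\times\mathbb X\times\mathbb R_+,$$ with $\|z\|=\sqrt{\|x\|^2+\|y\|^2+t^2}$ (the derivative in $t$ being $2t$). **KL functions.** For $\varpi\in(0,\infty]$, $\Upsilon_\varpi$ is the set of continuous concave $\varphi:[0,\varpi)\to\mathbb R_+$ that are continuously differentiable on $(0,\varpi)$ with $\varphi(0)=0$ and $\varphi'>0$ on $(0,\varpi)$. A proper function $h$ has the KL property at $\overline z\in{\rm dom}\,\partial h$ ($\partial h$ the limiting subdifferential) if there are $\delta>0$, $\varpi\in(0,\infty]$, $\varphi\in\Upsilon_\varpi$ such that $\varphi'(h(z)-h(\overline z))\,{\rm dist}(0,\partial h(z))\ge1$ for all $z$ with $\|z-\overline z\|\le\delta$ and $h(\overline z)<h(z)<h(\overline z)+\varpi$. $h$ is a KL function if it has the KL property at every point of ${\rm dom}\,\partial h$. *)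

theory Defs
  imports "HOL-Analysis.Analysis"
begin

section \<open>Extended-real-valued functions\<close>

definition effdom :: "('a \<Rightarrow> ereal) \<Rightarrow> 'a set" where
  "effdom h = {x. h x < \<infinity>}"

definition proper_fun :: "('a \<Rightarrow> ereal) \<Rightarrow> bool" where
  "proper_fun h \<longleftrightarrow> (\<forall>x. h x \<noteq> -\<infinity>) \<and> (\<exists>x. h x < \<infinity>)"

definition lsc_fun :: "('a::topological_space \<Rightarrow> ereal) \<Rightarrow> bool" where
  "lsc_fun h \<longleftrightarrow> (\<forall>x. h x \<le> Liminf (at x) h)"

text \<open>Used only for functions that never take the value \<open>-\<infinity>\<close>, so the
  right-hand side is never of the form \<open>\<infinity> - \<infinity>\<close>.\<close>

definition convex_fun :: "('a::real_vector \<Rightarrow> ereal) \<Rightarrow> bool" where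
  "convex_fun h \<longleftrightarrow> (\<forall>x y. \<forall>t\<in>{0<..<1::real}.
     h ((1 - t) *\<^sub>R x + t *\<^sub>R y) \<le> ereal (1 - t) * h x + ereal t * h y)"

text \<open>The gradient is meaningful only at points around which \<open>h\<close> is finite and at which
  it is differentiable.\<close>

definition grad :: "('a::real_inner \<Rightarrow> ereal) \<Rightarrow> 'a \<Rightarrow> 'a" where
  "grad h x = (THE v. GDERIV (\<lambda>u. real_of_ereal (h u)) x :> v)"

definition twice_cont_diff_on :: "('a::real_inner \<Rightarrow> ereal) \<Rightarrow> 'a set \<Rightarrow> bool" where
  "twice_cont_diff_on h S \<longleftrightarrow>
     (\<forall>x\<in>S. \<bar>h x\<bar> \<noteq> \<infinity>) \<and>
     (\<forall>x\<in>S. GDERIV (\<lambda>u. real_of_ereal (h u)) x :> grad h x) \<and>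
     (\<exists>H :: 'a \<Rightarrow> 'a \<Rightarrow>\<^sub>L 'a. continuous_on S H \<and>
        (\<forall>x\<in>S. (grad h has_derivative blinfun_apply (H x)) (at x)))"


section \<open>Subdifferentials and the Kurdyka-Lojasiewicz property\<close>

definition regular_subdiff :: "('a::real_inner \<Rightarrow> ereal) \<Rightarrow> 'a \<Rightarrow> 'a set" where
  "regular_subdiff h x = {v. \<bar>h x\<bar> \<noteq> \<infinity> \<and>
     0 \<le> Liminf (at x) (\<lambda>u. (h u - h x - ereal (v \<bullet> (u - x))) / ereal (norm (u - x)))}"

definition limiting_subdiff :: "('a::real_inner \<Rightarrow> ereal) \<Rightarrow> 'a \<Rightarrow> 'a set" where
  "limiting_subdiff h x = {v. \<bar>h x\<bar> \<noteq> \<infinity> \<and>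
     (\<exists>xs vs. xs \<longlonglongrightarrow> x \<and> (\<lambda>n. h (xs n)) \<longlonglongrightarrow> h x \<and>
        (\<forall>n. vs n \<in> regular_subdiff h (xs n)) \<and> vs \<longlonglongrightarrow> v)}"

text \<open>Unlike for \<^const>\<open>infdist\<close>, the distance to the empty set is \<open>\<infinity>\<close>.\<close>

definition dist_zero :: "'a::real_normed_vector set \<Rightarrow> ereal" where
  "dist_zero S = (INF v\<in>S. ereal (norm v))"

definition Upsilon :: "ereal \<Rightarrow> (real \<Rightarrow> real) set" where
  "Upsilon w = {\<phi>.
     continuous_on {s. 0 \<le> s \<and> ereal s < w} \<phi> \<and>
     concave_on {s. 0 \<le> s \<and> ereal s < w} \<phi> \<and>
     (\<forall>s. 0 \<le> s \<and> ereal s < w \<longrightarrow> 0 \<le> \<phi> s) \<and>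
     \<phi> 0 = 0 \<and>
     (\<forall>s. 0 < s \<and> ereal s < w \<longrightarrow> \<phi> differentiable (at s) \<and> 0 < deriv \<phi> s) \<and>
     continuous_on {s. 0 < s \<and> ereal s < w} (deriv \<phi>)}"

text \<open>The KL property of \<open>h\<close> considered as a function on the set \<open>Z\<close>: the points
  of \<open>Z\<close> are tested, and \<open>Z = UNIV\<close> gives the usual notion. Subdifferentials are
  those of \<open>h\<close> on the whole space.\<close>

definition KL_property_on :: "'a::real_inner set \<Rightarrow> ('a \<Rightarrow> ereal) \<Rightarrow> 'a \<Rightarrow> bool" where
  "KL_property_on Z h zb \<longleftrightarrow>
     (\<exists>\<delta>>0. \<exists>w>0. \<exists>\<phi>\<in>Upsilon w. \<forall>z\<in>Z.
        norm (z - zb) \<le> \<delta> \<and> h zb < h z \<and> h z < h zb + w \<longrightarrow>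
        1 \<le> ereal (deriv \<phi> (real_of_ereal (h z - h zb))) * dist_zero (limiting_subdiff h z))"

definition KL_function_on :: "'a::real_inner set \<Rightarrow> ('a \<Rightarrow> ereal) \<Rightarrow> bool" where
  "KL_function_on Z h \<longleftrightarrow> proper_fun h \<and>
     (\<forall>zb\<in>Z. limiting_subdiff h zb \<noteq> {} \<longrightarrow> KL_property_on Z h zb)"


section \<open>Composite problem, stationary points and potential function\<close>

definition stationary_points :: "('a::real_inner \<Rightarrow> ereal) \<Rightarrow> ('a \<Rightarrow> ereal) \<Rightarrow> 'a set" where
  "stationary_points f g = {x. 0 \<in> (\<lambda>v. grad f x + v) ` limiting_subdiff g x}"

definition fb_envelope ::
    "('a::real_inner \<Rightarrow> ereal) \<Rightarrow> ('a \<Rightarrow> ereal) \<Rightarrow> real \<Rightarrow> 'a \<Rightarrow> ereal" where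
  "fb_envelope f g \<gamma> x =
     (if x \<in> closure (effdom g)
      then INF y. g y + ereal (grad f x \<bullet> (y - x) + 1 / (2 * \<gamma>) * (norm (y - x))\<^sup>2) + f x
      else \<infinity>)"

text \<open>The formula is used for every real \<open>t\<close>, so that the derivative in \<open>t\<close> is
  \<open>2 t\<close> also at \<open>t = 0\<close>; the restriction to \<open>t \<ge> 0\<close> is carried by \<open>Zspace\<close>.
  The norm of the product type is the Euclidean one.\<close>

definition Phi :: "('a::real_inner \<Rightarrow> ereal) \<Rightarrow> ('a \<Rightarrow> ereal) \<Rightarrow> real \<Rightarrow> real
    \<Rightarrow> 'a \<times> 'a \<times> real \<Rightarrow> ereal" where
  "Phi f g L \<gamma> = (\<lambda>(x, y, t).
     fb_envelope f g \<gamma> x + ereal (L / 2 * (norm (y - x))\<^sup>2) + ereal (t\<^sup>2))"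

definition Zspace :: "('a \<times> 'a \<times> real) set" where
  "Zspace = UNIV \<times> UNIV \<times> {0..}"


section \<open>The line-search based variable metric inexact proximal gradient method\<close>

definition self_adjoint :: "('a::real_inner \<Rightarrow> 'a) \<Rightarrow> bool" where
  "self_adjoint A \<longleftrightarrow> linear A \<and> (\<forall>x y. A x \<bullet> y = x \<bullet> A y)"

definition op_ge :: "('a::real_inner \<Rightarrow> 'a) \<Rightarrow> ('a \<Rightarrow> 'a) \<Rightarrow> bool" where
  "op_ge A B \<longleftrightarrow> self_adjoint (\<lambda>x. A x - B x) \<and> (\<forall>x. 0 \<le> x \<bullet> (A x - B x))"

definition Theta :: "('a::real_inner \<Rightarrow> ereal) \<Rightarrow> ('a \<Rightarrow> ereal) \<Rightarrow> ('a \<Rightarrow> 'a) \<Rightarrow> 'a \<Rightarrow> 'a \<Rightarrow> ereal"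
  where
  "Theta f g A u x =
     f u + ereal (grad f u \<bullet> (x - u) + 1 / 2 * ((x - u) \<bullet> A (x - u))) + g x"

definition is_unique_minimizer :: "('a \<Rightarrow> ereal) \<Rightarrow> 'a \<Rightarrow> bool" where
  "is_unique_minimizer h x \<longleftrightarrow> (\<forall>u. u \<noteq> x \<longrightarrow> h x < h u)"

definition sufficient_decrease ::
    "('a::real_normed_vector \<Rightarrow> ereal) \<Rightarrow> real \<Rightarrow> real \<Rightarrow> 'a \<Rightarrow> 'a \<Rightarrow> nat \<Rightarrow> bool" where
  "sufficient_decrease F \<beta> \<sigma> u d m \<longleftrightarrow>
     F u - F (u + \<beta> ^ m *\<^sub>R d) \<ge> ereal (\<sigma> * \<beta> ^ m * (norm d)\<^sup>2)"

text \<open>One iteration with metric \<open>A\<close> and inexactness parameter \<open>e\<close>, leading from \<open>u\<close>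
  to \<open>u'\<close> through the inexact proximal point \<open>y\<close>.\<close>

definition VMiPG_step ::
    "('a::real_inner \<Rightarrow> ereal) \<Rightarrow> ('a \<Rightarrow> ereal) \<Rightarrow> real \<Rightarrow> real \<Rightarrow> real \<Rightarrow> real
     \<Rightarrow> ('a \<Rightarrow> 'a) \<Rightarrow> 'a \<Rightarrow> 'a \<Rightarrow> 'a \<Rightarrow> bool" where
  "VMiPG_step f g \<mu> \<beta> \<sigma> e A u y u' \<longleftrightarrow>
     self_adjoint A \<and> op_ge A (\<lambda>x. \<mu> *\<^sub>R x) \<and>
     Theta f g A u y < Theta f g A u u \<and>
     (\<exists>xb. is_unique_minimizer (Theta f g A u) xb \<and>
        Theta f g A u y - Theta f g A u xb \<le> ereal (e * (norm (y - u))\<^sup>2)) \<and>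
     (\<exists>m. sufficient_decrease (\<lambda>x. f x + g x) \<beta> \<sigma> u (y - u) m \<and>
        (\<forall>j<m. \<not> sufficient_decrease (\<lambda>x. f x + g x) \<beta> \<sigma> u (y - u) j) \<and>
        (let v = u + \<beta> ^ m *\<^sub>R (y - u)
         in u' = (if f y + g y < f v + g v then y else v)))"

definition VMiPG ::
    "('a::real_inner \<Rightarrow> ereal) \<Rightarrow> ('a \<Rightarrow> ereal) \<Rightarrow> real \<Rightarrow> real \<Rightarrow> real \<Rightarrow> (nat \<Rightarrow> real)
     \<Rightarrow> (nat \<Rightarrow> 'a \<Rightarrow> 'a) \<Rightarrow> (nat \<Rightarrow> 'a) \<Rightarrow> (nat \<Rightarrow> 'a) \<Rightarrow> bool" where
  "VMiPG f g \<mu> \<beta> \<sigma> \<epsilon> G x y \<longleftrightarrow>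
     0 < \<mu> \<and> 0 < \<beta> \<and> \<beta> < 1 \<and> 0 < \<sigma> \<and> \<sigma> < 1 / 2 * min 1 \<mu> \<and>
     (\<forall>k. 0 < \<epsilon> k) \<and> bounded (range \<epsilon>) \<and> (\<exists>kb. \<forall>k\<ge>kb. \<epsilon> k \<le> \<mu> / 10) \<and>
     x 0 \<in> effdom g \<and>
     (\<forall>k. VMiPG_step f g \<mu> \<beta> \<sigma> (\<epsilon> k) (G k) (x k) (y k) (x (Suc k)))"

end

theory Submission
  imports Defs
begin

text \<open>The decrease of \<open>F = f + g\<close> along the iterates gives only
  \<open>\<Sum> (norm d\<^sub>k)\<^sup>2 < \<infinity>\<close> for the directions \<open>d\<^sub>k = y\<^sub>k - x\<^sub>k\<close>: a trial step of length at most
  \<open>(\<mu> - 2 * \<sigma>) / L\<close> passes the line search, so the accepted step lengths stay away from zero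
  (\<open>VMiPG_step_descent\<close>). Summability of \<open>norm d\<^sub>k\<close> itself comes from the KL property.
  Neither \<open>F\<close> nor its forward-backward envelope can be used for this alone: the residual that the method
  controls bounds subgradients of the envelope, and the descent is in \<open>F\<close>.
  The potential \<open>\<Phi>\<close> links the two, through the sandwich
  \<open>F x\<^sub>k\<^sub>+\<^sub>1 \<le> F y\<^sub>k \<le> \<Phi> (x\<^sub>k, y\<^sub>k, 0) \<le> F x\<^sub>k + L / 2 * (norm d\<^sub>k)\<^sup>2\<close>,
  valid for large \<open>k\<close>. The middle inequality is the descent lemma for \<open>f\<close> combined with
  \<open>\<gamma> \<le> 1 / \<mu>'\<close>: the quadratic model with metric \<open>G\<^sub>k\<close> lies below the one with metric \<open>I / \<gamma>\<close>, whose
  minimal value is the envelope (\<open>inexact_minimizer_bounds\<close>).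

  The envelope has at every point of the closed domain of \<open>g\<close> an explicit regular subgradient of norm at
  most a constant times the forward-backward residual (\<open>env_lower_expansion\<close>,
  \<open>norm_env_grad_le\<close>). The residual in turn is at most \<open>4 * norm d\<^sub>k\<close>, because
  \<open>y\<^sub>k\<close> nearly minimizes the model with metric \<open>G\<^sub>k\<close> and the minimizers for two metrics are comparable
  (\<open>norm_forward_backward_residual_le\<close>). Hence
  \<open>dist(0, \<partial>\<Phi>(x\<^sub>k, y\<^sub>k, 0)) \<le> C * norm d\<^sub>k\<close>. Since a desingularizing function has decreasing derivative,
  the KL inequality at \<open>(x\<^sub>k, y\<^sub>k, 0)\<close> can be read at the smaller value
  \<open>F(x\<^sub>k\<^sub>+\<^sub>1) - lim F\<close>, and combined with the descent of \<open>F\<close> in the next iteration it yields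
  \<open>2 * norm d\<^sub>k\<^sub>+\<^sub>1 \<le> norm d\<^sub>k\<close> plus a telescoping term. Starting close enough to a cluster point, where the
  KL property is available, the iterates never leave its neighbourhood
  (\<open>KL_descent_imp_finite_length\<close>). The cluster point is a fixed point of the forward-backward
  step, since the residuals tend to zero, and fixed points are stationary.\<close>

section \<open>Lower semicontinuity and subgradients\<close>

lemma lsc_fun_open_superlevel:
  assumes "lsc_fun h"
  shows "open {x. c < h x}"
proof (subst open_subopen, intro ballI)
  fix x assume x: "x \<in> {x. c < h x}"
  then have "c < Liminf (at x) h"
    using assms unfolding lsc_fun_def by (meson less_le_trans mem_Collect_eq)
  then have "eventually (\<lambda>u. c < h u) (at x)"
    by (rule less_LiminfD)
  then have "eventually (\<lambda>u. c < h u) (nhds x)"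
    using x unfolding eventually_at_filter by (auto elim!: eventually_mono)
  then show "\<exists>T. open T \<and> x \<in> T \<and> T \<subseteq> {x. c < h x}"
    unfolding eventually_nhds by auto
qed

text \<open>If no point of \<open>K\<close> were a minimizer, the superlevel sets \<open>{x. h u < h x}\<close> with
  \<open>u \<in> K\<close> would cover \<open>K\<close>; the best of the finitely many \<open>u\<close> that suffice is itself not covered.\<close>

lemma lsc_fun_attains_inf:
  assumes "lsc_fun h" "compact K" "K \<noteq> {}"
  obtains p where "p \<in> K" "\<And>u. u \<in> K \<Longrightarrow> h p \<le> h u"
proof -
  have "\<exists>p\<in>K. \<forall>u\<in>K. h p \<le> h u"
  proof (rule ccontr)
    assume "\<not> ?thesis"
    then have cover: "K \<subseteq> (\<Union>u\<in>K. {x. h u < h x})"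
      by (auto simp: not_le)
    obtain C where C: "C \<subseteq> K" "finite C" "K \<subseteq> (\<Union>u\<in>C. {x. h u < h x})"
      using compactE_image[OF \<open>compact K\<close> _ cover] lsc_fun_open_superlevel[OF assms(1)] by metis
    then have "C \<noteq> {}" using \<open>K \<noteq> {}\<close> by auto
    then have "Min (h ` C) \<in> h ` C" using C(2) by (intro Min_in) auto
    then obtain m where m: "m \<in> C" "Min (h ` C) = h m" by (rule imageE)
    have least: "h m \<le> h u" if "u \<in> C" for u
      unfolding m(2)[symmetric] using C(2) that by (intro Min_le) auto
    from m(1) C(1,3) obtain u where "u \<in> C" "h u < h m" by blast
    then show False using least by (simp add: leD)
  qed
  then show thesis using that by blast
qed

lemma lsc_fun_add_continuous:
  fixes q :: "'a::t2_space \<Rightarrow> real"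
  assumes "lsc_fun h" "continuous_on UNIV q"
  shows "lsc_fun (\<lambda>x. ereal (q x) + h x)"
  unfolding lsc_fun_def le_Liminf_iff
proof (intro allI impI)
  fix x c assume c: "c < ereal (q x) + h x"
  obtain c' where c': "c < ereal c'" "ereal c' < ereal (q x) + h x"
    using ereal_dense2[OF c] by blast
  have "ereal (c' - q x) < h x"
    using c'(2) by (cases "h x") auto
  then obtain e' where e': "ereal (c' - q x) < ereal e'" "ereal e' < h x"
    using ereal_dense2 by blast
  have "c' - e' < q x" using e'(1) by simp
  moreover have "(q \<longlongrightarrow> q x) (at x)"
    using assms(2) by (simp add: continuous_on_def)
  ultimately have "eventually (\<lambda>u. c' - e' < q u) (at x)"
    by (simp add: order_tendstoD)
  moreover have "eventually (\<lambda>u. ereal e' < h u) (at x)"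
    using assms(1) e'(2) unfolding lsc_fun_def by (intro less_LiminfD) (blast intro: less_le_trans)
  ultimately show "eventually (\<lambda>u. c < ereal (q u) + h u) (at x)"
  proof eventually_elim
    case (elim u)
    then have "ereal c' < ereal (q u) + h u" by (cases "h u") auto
    then show ?case using c'(1) by order
  qed
qed

text \<open>The definition by a lower limit of difference quotients, restated as an expansion with error
  \<open>o(norm (u - x))\<close>, which is the form in which subgradients are found below.\<close>

lemma regular_subdiffI:
  fixes h :: "'a::real_inner \<Rightarrow> ereal"
  assumes fin: "\<bar>h x\<bar> \<noteq> \<infinity>"
    and lower: "\<And>e. e > 0 \<Longrightarrow>
      eventually (\<lambda>u. h x + ereal (v \<bullet> (u - x) - e * norm (u - x)) \<le> h u) (at x)"
  shows "v \<in> regular_subdiff h x"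
proof -
  have "0 \<le> Liminf (at x) (\<lambda>u. (h u - h x - ereal (v \<bullet> (u - x))) / ereal (norm (u - x)))"
    (is "0 \<le> ?L")
  proof (rule ccontr)
    assume "\<not> 0 \<le> ?L"
    then obtain r where r: "?L < ereal r" "ereal r < 0"
      using ereal_dense2 by (meson not_le)
    define e where "e = - r"
    have "e > 0" using r(2) by (simp add: e_def)
    have "ereal (- e) \<le> ?L"
    proof (rule Liminf_bounded)
      have "eventually (\<lambda>u. u \<noteq> x) (at x)" by (simp add: eventually_at_filter)
      then show "eventually (\<lambda>u. ereal (- e) \<le>
          (h u - h x - ereal (v \<bullet> (u - x))) / ereal (norm (u - x))) (at x)"
        using lower[OF \<open>e > 0\<close>]
      proof eventually_elim
        case (elim u)
        then have n: "norm (u - x) > 0" by simp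
        obtain a where a: "h x = ereal a" using fin by auto
        show ?case
        proof (cases "h u")
          case (real b)
          have "- e * norm (u - x) \<le> b - a - v \<bullet> (u - x)"
            using elim(2) real a by simp
          then have "- e \<le> (b - a - v \<bullet> (u - x)) / norm (u - x)"
            using n by (simp add: pos_le_divide_eq)
          then show ?thesis using real a n by simp
        next
          case PInf then show ?thesis using a n by (simp add: divide_ereal_def)
        next
          case MInf then show ?thesis using a elim by simp
        qed
      qed
    qed
    then show False
      using r(1) by (simp add: e_def)
  qed
  then show ?thesis using fin by (simp add: regular_subdiff_def)
qed

lemma regular_subdiff_subset_limiting: "regular_subdiff h x \<subseteq> limiting_subdiff h x"
proof
  fix v assume v: "v \<in> regular_subdiff h x"
  then have "\<bar>h x\<bar> \<noteq> \<infinity>" by (simp add: regular_subdiff_def)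
  then show "v \<in> limiting_subdiff h x"
    unfolding limiting_subdiff_def mem_Collect_eq
    using v by (intro conjI exI[of _ "\<lambda>_. x"] exI[of _ "\<lambda>_. v"]) auto
qed

lemma dist_zero_le_norm: "v \<in> S \<Longrightarrow> dist_zero S \<le> ereal (norm v)"
  unfolding dist_zero_def by (rule INF_lower)

section \<open>Desingularizing functions and finite length\<close>

lemma Upsilon_tangent:
  assumes "\<phi> \<in> Upsilon w" "0 < s" "ereal s < w" "0 \<le> t" "ereal t < w"
  shows "\<phi> t \<le> \<phi> s + deriv \<phi> s * (t - s)"
proof -
  let ?S = "{s. 0 \<le> s \<and> ereal s < w}"
  have conv: "convex_on ?S (\<lambda>s. - \<phi> s)"
    using assms(1) unfolding Upsilon_def concave_on_def by auto
  then have "connected ?S" using convex_connected convex_on_imp_convex by blast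
  have op: "open {s. 0 < s \<and> ereal s < w}"
    by (intro open_Collect_conj open_Collect_less continuous_intros)
  have int: "s \<in> interior ?S"
    using assms(2,3) by (intro interiorI[OF op]) auto
  have "\<phi> differentiable (at s)"
    using assms unfolding Upsilon_def by auto
  then have "(\<phi> has_field_derivative deriv \<phi> s) (at s)"
    by (simp add: DERIV_deriv_iff_real_differentiable)
  then have "((\<lambda>s. - \<phi> s) has_field_derivative - deriv \<phi> s) (at s within ?S)"
    by (intro DERIV_minus) (rule has_field_derivative_at_within)
  then have "- \<phi> t - (- \<phi> s) \<ge> - deriv \<phi> s * (t - s)"
    by (intro convex_on_imp_above_tangent[OF conv \<open>connected ?S\<close> int]) (use assms(4,5) in auto)
  then show ?thesis by (simp add: algebra_simps)
qed

text \<open>Adding the two tangent inequalities at \<open>s\<close> and \<open>t\<close> gives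
  \<open>0 \<le> (\<phi>' s - \<phi>' t) * (t - s)\<close>.\<close>

lemma Upsilon_deriv_antimono:
  assumes "\<phi> \<in> Upsilon w" "0 < s" "s \<le> t" "ereal t < w"
  shows "deriv \<phi> t \<le> deriv \<phi> s"
proof (cases "s = t")
  case False
  have sw: "ereal s < w" using assms(3,4) by (meson ereal_less_eq(3) le_less_trans)
  have "0 \<le> (deriv \<phi> s - deriv \<phi> t) * (t - s)"
    using Upsilon_tangent[of \<phi> w s t] Upsilon_tangent[of \<phi> w t s] assms sw
    by (simp add: algebra_simps)
  then show ?thesis using False assms(3)
    by (simp add: zero_le_mult_iff)
qed simp

text \<open>The inequality of arithmetic and geometric means. It turns the product produced by the KL inequality into a
  contraction plus a remainder.\<close>

lemma double_le_sum_if_square_le_mult: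
  fixes u d v :: real
  assumes "u\<^sup>2 \<le> d * v" "d > 0"
  shows "2 * u \<le> d + v"
proof -
  have "0 \<le> d * v" using assms(1) zero_le_power2[of u] by linarith
  then have "0 \<le> v" using assms(2) by (simp add: zero_le_mult_iff)
  have "(2 * u)\<^sup>2 \<le> 4 * (d * v)" using assms(1) by (simp add: power_mult_distrib)
  also have "\<dots> \<le> (d + v)\<^sup>2"
    using zero_le_power2[of "d - v"] by (simp add: power2_eq_square algebra_simps)
  finally show ?thesis
    by (rule power2_le_imp_le) (use assms(2) \<open>0 \<le> v\<close> in simp)
qed

lemma descent_imp_steps_vanish:
  fixes r D :: "nat \<Rightarrow> real"
  assumes "\<And>k. a * (D k)\<^sup>2 \<le> r k - r (Suc k)" "a > 0" "\<And>k. 0 \<le> D k" "r \<longlonglongrightarrow> l"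
  shows "D \<longlonglongrightarrow> 0"
proof -
  have "(\<lambda>k. (r k - r (Suc k)) / a) \<longlonglongrightarrow> (l - l) / a"
    using assms(2) by (intro tendsto_intros assms(4) LIMSEQ_Suc[OF assms(4)]) auto
  then have upper: "(\<lambda>k. (r k - r (Suc k)) / a) \<longlonglongrightarrow> 0" by simp
  have "norm ((D k)\<^sup>2) \<le> (r k - r (Suc k)) / a" for k
    using assms(1)[of k] assms(2) by (simp add: pos_le_divide_eq mult.commute)
  then have bound: "eventually (\<lambda>k. norm ((D k)\<^sup>2) \<le> (r k - r (Suc k)) / a) sequentially"
    by simp
  have "(\<lambda>k. (D k)\<^sup>2) \<longlonglongrightarrow> 0"
    by (rule Lim_null_comparison[OF bound upper])
  from tendsto_real_sqrt[OF this] show ?thesis using assms(3) by simp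
qed

text \<open>The KL argument, separated from the algorithm: \<open>r\<close> are the gaps of the objective to its limit and
  \<open>D\<close> bounds the step lengths. Multiplying the descent inequality at \<open>k + 1\<close> by
  \<open>\<phi>' (r (k + 1))\<close>, and using the tangent inequality on one side and the KL inequality at \<open>k\<close> on the other,
  \<open>(D (k + 1))\<^sup>2\<close> is at most \<open>D k\<close> times the decrease of \<open>(C / a) * (\<phi> \<circ> r)\<close>, so that
  \<open>2 * D (k + 1) \<le> D k\<close> plus that decrease. Summed up, the length of the trajectory from an index \<open>K\<close>
  on is at most \<open>2 * D K + (C / a) * \<phi> (r (K + 1))\<close>. The KL inequality holds only in a ball around
  \<open>xb\<close>; but this bound is small for large \<open>K\<close>, so a trajectory that comes close to \<open>xb\<close> late enough
  is trapped in the ball. The gap in the KL inequality is taken one index later than the step length, because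
  that is what the potential function delivers.\<close>

lemma KL_descent_imp_finite_length:
  fixes x :: "nat \<Rightarrow> 'a::banach" and r D :: "nat \<Rightarrow> real"
  assumes step: "\<And>k. norm (x (Suc k) - x k) \<le> D k"
    and decrease: "\<And>k. a * (D k)\<^sup>2 \<le> r k - r (Suc k)" and "a > 0"
    and r_pos: "\<And>k. 0 < r k" and r_lim: "r \<longlonglongrightarrow> 0"
    and \<phi>: "\<phi> \<in> Upsilon w" and "w > 0"
    and cluster: "strict_mono s" "(\<lambda>i. x (s i)) \<longlonglongrightarrow> xb" and "\<delta> > 0"
    and KL: "\<And>k. k \<ge> K0 \<Longrightarrow> norm (x k - xb) \<le> \<delta> \<Longrightarrow>
       ereal (r (Suc k)) < w \<and> 1 \<le> deriv \<phi> (r (Suc k)) * (C * D k)"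
  shows "summable (\<lambda>k. norm (x (Suc k) - x k))" "x \<longlonglongrightarrow> xb"
proof -
  have D_nonneg: "0 \<le> D k" for k
    using step[of k] norm_ge_zero order_trans by blast
  have r_mono: "r (Suc k) \<le> r k" for k
  proof -
    have "0 \<le> a * (D k)\<^sup>2" using \<open>a > 0\<close> by simp
    then show ?thesis using decrease[of k] by linarith
  qed
  have D_lim: "D \<longlonglongrightarrow> 0"
    by (rule descent_imp_steps_vanish[OF decrease \<open>a > 0\<close> D_nonneg r_lim])
  have recursion: "2 * D (Suc k) \<le> D k + C / a * (\<phi> (r (Suc k)) - \<phi> (r (Suc (Suc k))))"
    if "k \<ge> K0" "norm (x k - xb) \<le> \<delta>" for k
  proof -
    let ?q = "deriv \<phi> (r (Suc k))" and ?\<Delta> = "\<phi> (r (Suc k)) - \<phi> (r (Suc (Suc k)))"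
    have w: "ereal (r (Suc k)) < w" and one: "1 \<le> ?q * (C * D k)" using KL[OF that] by auto
    have w2: "ereal (r (Suc (Suc k))) < w"
      using w r_mono[of "Suc k"] by (meson ereal_less_eq(3) le_less_trans)
    have q: "?q > 0" using \<phi> r_pos w by (auto simp: Upsilon_def)
    have CD: "C * D k > 0" using zero_less_mult_pos[OF less_le_trans[OF zero_less_one one] q] .
    have "?q * (a * (D (Suc k))\<^sup>2) \<le> ?q * (r (Suc k) - r (Suc (Suc k)))"
      using decrease q by simp
    also have "\<dots> \<le> ?\<Delta>"
      using Upsilon_tangent[OF \<phi> r_pos w less_imp_le[OF r_pos] w2] by (simp add: algebra_simps)
    finally have "?q * (a * (D (Suc k))\<^sup>2) \<le> ?\<Delta>" .
    from mult_left_mono[OF this less_imp_le[OF CD]]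
    have "(?q * (C * D k)) * (a * (D (Suc k))\<^sup>2) \<le> (C * D k) * ?\<Delta>"
      by (simp only: mult_ac)
    moreover have "a * (D (Suc k))\<^sup>2 \<le> (?q * (C * D k)) * (a * (D (Suc k))\<^sup>2)"
      using mult_right_mono[OF one, of "a * (D (Suc k))\<^sup>2"] \<open>a > 0\<close> by simp
    ultimately have "a * (D (Suc k))\<^sup>2 \<le> (C * D k) * ?\<Delta>"
      by (rule order_trans[rotated])
    then have "(D (Suc k))\<^sup>2 \<le> (C * D k) * ?\<Delta> / a"
      using \<open>a > 0\<close> by (simp add: pos_le_divide_eq mult.commute)
    then have le: "(D (Suc k))\<^sup>2 \<le> D k * (C / a * ?\<Delta>)"
      by (simp add: mult_ac)
    have "D k > 0" using CD D_nonneg[of k] by (cases "D k = 0") auto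
    with le show ?thesis by (rule double_le_sum_if_square_le_mult)
  qed
  have \<phi>_lim: "(\<lambda>k. \<phi> (r (Suc k))) \<longlonglongrightarrow> 0"
  proof -
    have "eventually (\<lambda>k. ereal (r (Suc k)) < w) sequentially"
      using \<open>w > 0\<close> LIMSEQ_Suc[OF r_lim] by (intro order_tendstoD(2)[of _ "ereal 0"]) (auto simp: zero_ereal_def)
    then have "eventually (\<lambda>k. r (Suc k) \<in> {s. 0 \<le> s \<and> ereal s < w}) sequentially"
      by eventually_elim (use r_pos less_imp_le in auto)
    then have "(\<lambda>k. \<phi> (r (Suc k))) \<longlonglongrightarrow> \<phi> 0"
      using \<phi> \<open>w > 0\<close> LIMSEQ_Suc[OF r_lim]
      by (intro continuous_on_tendsto_compose[of "{s. 0 \<le> s \<and> ereal s < w}" \<phi>])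
         (auto simp: Upsilon_def zero_ereal_def)
    then show ?thesis using \<phi> by (simp add: Upsilon_def)
  qed
  \<comment> \<open>Enter the ball so late that the whole remaining length fits into it.\<close>
  have "(\<lambda>i. norm (x (s i) - xb) + (2 * D (s i) + C / a * \<phi> (r (Suc (s i)))))
      \<longlonglongrightarrow> norm (xb - xb) + (2 * 0 + C / a * 0)"
    by (intro tendsto_intros cluster(2) LIMSEQ_subseq_LIMSEQ[OF D_lim cluster(1), unfolded o_def]
        LIMSEQ_subseq_LIMSEQ[OF \<phi>_lim cluster(1), unfolded o_def])
  then have "eventually (\<lambda>i. norm (x (s i) - xb) + (2 * D (s i) + C / a * \<phi> (r (Suc (s i)))) < \<delta>)
      sequentially"
    using \<open>\<delta> > 0\<close> by (intro order_tendstoD(2)) auto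
  moreover have "(\<lambda>i. norm (x (s i) - xb)) \<longlonglongrightarrow> norm (xb - xb)"
    by (intro tendsto_intros cluster(2))
  then have "eventually (\<lambda>i. norm (x (s i) - xb) < \<delta>) sequentially"
    using \<open>\<delta> > 0\<close> by (intro order_tendstoD(2)) auto
  moreover have "eventually (\<lambda>i. s i \<ge> K0) sequentially"
    using filterlim_subseq[OF cluster(1)] by (auto simp: filterlim_at_top)
  ultimately obtain K where K: "K \<ge> K0" and start: "norm (x K - xb) < \<delta>"
    and small: "norm (x K - xb) + (2 * D K + C / a * \<phi> (r (Suc K))) < \<delta>"
    using eventually_happens'[OF sequentially_bot eventually_conj[OF _ eventually_conj]]
    by (smt (verit, ccfv_threshold))
  let ?S = "\<lambda>n. \<Sum>j<n. D (K + j)"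
  have C_nonneg: "0 \<le> C / a * \<phi> (r (Suc k))" if "k \<ge> K0" "norm (x k - xb) \<le> \<delta>" for k
  proof -
    have w: "ereal (r (Suc k)) < w" and one: "1 \<le> deriv \<phi> (r (Suc k)) * (C * D k)"
      using KL[OF that] by auto
    have q: "deriv \<phi> (r (Suc k)) > 0" and "\<phi> (r (Suc k)) \<ge> 0"
      using \<phi> r_pos[of "Suc k"] w by (auto simp: Upsilon_def)
    moreover have "C * D k > 0"
      using zero_less_mult_pos[OF less_le_trans[OF zero_less_one one] q] .
    then have "C > 0" using D_nonneg[of k] by (simp add: zero_less_mult_iff)
    ultimately show ?thesis using \<open>a > 0\<close> by simp
  qed
  have dist_le: "norm (x (K + n) - x K) \<le> ?S n" for n
  proof (induction n)
    case (Suc n)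
    have "norm (x (K + Suc n) - x K)
        \<le> norm (x (Suc (K + n)) - x (K + n)) + norm (x (K + n) - x K)"
      using norm_triangle_ineq[of "x (Suc (K + n)) - x (K + n)" "x (K + n) - x K"] by simp
    then show ?case using Suc step[of "K + n"] by simp
  qed simp
  let ?B = "2 * D K + C / a * \<phi> (r (Suc K))"
  have in_ball: "norm (x (K + n) - xb) \<le> \<delta>" if "?S n \<le> ?B" for n
    using dist_le[of n] that small norm_triangle_ineq[of "x (K + n) - x K" "x K - xb"] by simp
  \<comment> \<open>The coefficient 2 of the last step is what makes the halved recursion telescope.\<close>
  have trapped: "?S n + 2 * D (K + n) + C / a * \<phi> (r (Suc (K + n))) \<le> ?B
      \<and> norm (x (K + n) - xb) \<le> \<delta>" for n
  proof (induction n)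
    case 0
    then show ?case using start by simp
  next
    case (Suc n)
    have "2 * D (Suc (K + n)) \<le> D (K + n)
        + C / a * (\<phi> (r (Suc (K + n))) - \<phi> (r (Suc (Suc (K + n)))))"
      using recursion[of "K + n"] K Suc by simp
    then have T: "?S (Suc n) + 2 * D (K + Suc n) + C / a * \<phi> (r (Suc (K + Suc n))) \<le> ?B"
      using Suc by (simp add: right_diff_distrib)
    have "?S n + D (K + n) \<le> ?B"
      using Suc C_nonneg[of "K + n"] K D_nonneg[of "K + n"] by linarith
    then show ?case using T in_ball[of "Suc n"] by simp
  qed
  have S_le: "?S n \<le> ?B" for n
    using trapped[of n] C_nonneg[of "K + n"] K D_nonneg[of "K + n"] by linarith
  have "summable (\<lambda>j. D (K + j))"
    by (rule summableI_nonneg_bounded[OF D_nonneg S_le])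
  then have "summable D" using summable_iff_shift[of D K] by (simp add: add.commute)
  then show sum: "summable (\<lambda>k. norm (x (Suc k) - x k))"
    using summable_comparison_test_ev[of "\<lambda>k. norm (x (Suc k) - x k)" D] step by simp
  \<comment> \<open>Finite length makes the sequence convergent; its limit must be the cluster point.\<close>
  have "x = (\<lambda>n. x 0 + (\<Sum>k<n. x (Suc k) - x k))"
    by (simp add: sum_lessThan_telescope)
  moreover have "convergent (\<lambda>n. x 0 + (\<Sum>k<n. x (Suc k) - x k))"
    using summable_norm_cancel[OF sum] summable_iff_convergent
    by (intro convergent_add convergent_const) blast
  ultimately have "convergent x" by simp
  then obtain l where l: "x \<longlonglongrightarrow> l" by (auto simp: convergent_def)
  then have "(\<lambda>i. x (s i)) \<longlonglongrightarrow> l"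
    using LIMSEQ_subseq_LIMSEQ[OF l cluster(1)] by (simp add: o_def)
  then show "x \<longlonglongrightarrow> xb" using l cluster(2) LIMSEQ_unique by blast
qed

section \<open>The quadratic model and its minimizers\<close>

locale composite_model =
  fixes f g :: "'a::euclidean_space \<Rightarrow> ereal" and Om :: "'a set"
  assumes proper_g: "proper_fun g" and lsc_g: "lsc_fun g" and convex_g: "convex_fun g"
    and open_Om: "open Om" and closure_dom_subset: "closure (effdom g) \<subseteq> Om"
    and smooth: "twice_cont_diff_on f Om"
begin

abbreviation fr :: "'a \<Rightarrow> real" where "fr x \<equiv> real_of_ereal (f x)"
abbreviation gr :: "'a \<Rightarrow> real" where "gr x \<equiv> real_of_ereal (g x)"
abbreviation D :: "'a set" where "D \<equiv> effdom g"

lemma dom_subset: "x \<in> D \<Longrightarrow> x \<in> Om" "x \<in> D \<Longrightarrow> x \<in> closure D"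
  "x \<in> closure D \<Longrightarrow> x \<in> Om"
  using closure_dom_subset closure_subset[of D] by auto

lemma f_eq: "x \<in> Om \<Longrightarrow> f x = ereal (fr x)"
  using smooth unfolding twice_cont_diff_on_def by (simp add: ereal_real')

lemma g_eq: "x \<in> D \<Longrightarrow> g x = ereal (gr x)" "x \<notin> D \<Longrightarrow> g x = \<infinity>"
proof -
  have "g x \<noteq> -\<infinity>" using proper_g by (simp add: proper_fun_def)
  then show "x \<in> D \<Longrightarrow> g x = ereal (gr x)" "x \<notin> D \<Longrightarrow> g x = \<infinity>"
    by (cases "g x"; simp add: effdom_def)+
qed

lemma dom_nonempty: "D \<noteq> {}"
  using proper_g by (auto simp: proper_fun_def effdom_def)

text \<open>Convexity of \<open>g\<close> for the real-valued \<open>gr\<close>, which carries information only on \<open>D\<close>.\<close>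

lemma gr_segment:
  assumes "u \<in> D" "v \<in> D" "0 < t" "t < 1"
  shows "(1 - t) *\<^sub>R u + t *\<^sub>R v \<in> D"
    and "gr ((1 - t) *\<^sub>R u + t *\<^sub>R v) \<le> (1 - t) * gr u + t * gr v"
proof -
  let ?z = "(1 - t) *\<^sub>R u + t *\<^sub>R v"
  have "g ?z \<le> ereal (1 - t) * g u + ereal t * g v"
    using convex_g assms(3,4) unfolding convex_fun_def by auto
  moreover obtain a b where "g u = ereal a" "g v = ereal b"
    using g_eq(1)[OF assms(1)] g_eq(1)[OF assms(2)] by blast
  ultimately have le: "g ?z \<le> ereal ((1 - t) * gr u + t * gr v)"
    by simp
  then show z: "?z \<in> D"
    by (cases "g ?z") (use le in \<open>auto simp: effdom_def\<close>)
  show "gr ?z \<le> (1 - t) * gr u + t * gr v"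
    using le g_eq(1)[OF z] by (cases "g ?z") auto
qed

lemma fr_has_derivative: "x \<in> Om \<Longrightarrow> (fr has_derivative (\<lambda>h. grad f x \<bullet> h)) (at x)"
  using smooth unfolding twice_cont_diff_on_def gderiv_def by (simp add: inner_commute)

definition hess :: "'a \<Rightarrow> 'a \<Rightarrow>\<^sub>L 'a" where
  "hess = (SOME H. continuous_on Om H \<and> (\<forall>x\<in>Om. (grad f has_derivative blinfun_apply (H x)) (at x)))"

lemma hess: "continuous_on Om hess"
  "x \<in> Om \<Longrightarrow> (grad f has_derivative blinfun_apply (hess x)) (at x)"
proof -
  have "\<exists>H :: 'a \<Rightarrow> 'a \<Rightarrow>\<^sub>L 'a.
      continuous_on Om H \<and> (\<forall>x\<in>Om. (grad f has_derivative blinfun_apply (H x)) (at x))"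
    using smooth unfolding twice_cont_diff_on_def by blast
  from someI_ex[OF this, folded hess_def]
  show "continuous_on Om hess"
    "x \<in> Om \<Longrightarrow> (grad f has_derivative blinfun_apply (hess x)) (at x)" by auto
qed

lemma isCont_grad: "x \<in> Om \<Longrightarrow> isCont (grad f) x"
  using hess(2) has_derivative_continuous by blast

lemma isCont_fr: "x \<in> Om \<Longrightarrow> isCont fr x"
  using fr_has_derivative has_derivative_continuous by blast

text \<open>The function \<open>f(u + t * (v - u)) - t * \<langle>grad f u, v - u\<rangle> - L / 2 * t\<^sup>2 * (norm (v - u))\<^sup>2\<close> of \<open>t\<close>
  has nonpositive derivative on \<open>[0, 1]\<close>.\<close>

lemma descent:
  assumes "L-lipschitz_on S (grad f)" "convex S" "S \<subseteq> Om" "u \<in> S" "v \<in> S"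
  shows "fr v \<le> fr u + grad f u \<bullet> (v - u) + L / 2 * (norm (v - u))\<^sup>2"
proof -
  let ?w = "v - u"
  let ?\<psi> = "\<lambda>t::real. fr (u + t *\<^sub>R ?w) - t * (grad f u \<bullet> ?w) - L / 2 * t\<^sup>2 * (norm ?w)\<^sup>2"
  have seg: "u + t *\<^sub>R ?w \<in> S" if "0 \<le> t" "t \<le> 1" for t
    using convexD_alt[OF assms(2,4,5) that] by (simp add: algebra_simps)
  have "?\<psi> 1 \<le> ?\<psi> 0"
  proof (rule DERIV_nonpos_imp_nonincreasing[of 0 1 ?\<psi>])
    fix t :: real assume t: "0 \<le> t" "t \<le> 1"
    let ?z = "u + t *\<^sub>R ?w"
    let ?d = "grad f ?z \<bullet> ?w - grad f u \<bullet> ?w - L * t * (norm ?w)\<^sup>2"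
    have "((\<lambda>t. fr (u + t *\<^sub>R ?w)) has_derivative (\<lambda>s. grad f ?z \<bullet> (s *\<^sub>R ?w))) (at t)"
      using seg[OF t] assms(3)
      by (intro has_derivative_compose[OF _ fr_has_derivative]) (auto intro!: derivative_eq_intros)
    moreover have "(\<lambda>s. grad f ?z \<bullet> (s *\<^sub>R ?w)) = (*) (grad f ?z \<bullet> ?w)"
      by (auto simp: fun_eq_iff)
    ultimately have "((\<lambda>t. fr (u + t *\<^sub>R ?w)) has_real_derivative grad f ?z \<bullet> ?w) (at t)"
      by (simp add: has_field_derivative_def)
    then have "DERIV ?\<psi> t :> ?d"
      by (auto intro!: derivative_eq_intros)
    moreover have "?d \<le> 0"
    proof -
      have "norm (grad f ?z - grad f u) \<le> L * norm (?z - u)"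
        using lipschitz_on_normD[OF assms(1) seg[OF t] assms(4)] .
      then have "norm (grad f ?z - grad f u) * norm ?w \<le> L * (t * norm ?w) * norm ?w"
        using t by (intro mult_right_mono) auto
      then show ?thesis
        using norm_cauchy_schwarz[of "grad f ?z - grad f u" ?w]
        by (simp add: inner_diff_left power2_eq_square mult.assoc)
    qed
    ultimately show "\<exists>y. DERIV ?\<psi> t :> y \<and> y \<le> 0" by blast
  qed simp
  then show ?thesis by simp
qed

text \<open>The finite part of \<^const>\<open>Theta\<close>. Both the subproblem of the method (metric \<open>G\<^sub>k\<close>) and the
  forward-backward step (metric \<open>I / \<gamma>\<close>) are instances, so that optimality conditions are proved once.\<close>

definition model :: "('a \<Rightarrow> 'a) \<Rightarrow> 'a \<Rightarrow> 'a \<Rightarrow> real" where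
  "model A u y = fr u + grad f u \<bullet> (y - u) + 1 / 2 * ((y - u) \<bullet> A (y - u)) + gr y"

lemma Theta_eq:
  assumes "u \<in> Om"
  shows "y \<in> D \<Longrightarrow> Theta f g A u y = ereal (model A u y)"
    and "y \<notin> D \<Longrightarrow> Theta f g A u y = \<infinity>"
proof -
  obtain a where a: "f u = ereal a" using f_eq[OF assms] by blast
  show "Theta f g A u y = ereal (model A u y)" if y: "y \<in> D"
  proof -
    obtain b where "g y = ereal b" using g_eq(1)[OF y] by blast
    then show ?thesis using a by (simp add: Theta_def model_def)
  qed
  show "Theta f g A u y = \<infinity>" if "y \<notin> D"
    using a g_eq(2)[OF that] by (simp add: Theta_def)
qed

definition model_min :: "('a \<Rightarrow> 'a) \<Rightarrow> 'a \<Rightarrow> 'a \<Rightarrow> bool" where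
  "model_min A u p \<longleftrightarrow> p \<in> D \<and> (\<forall>y\<in>D. model A u p \<le> model A u y)"

lemma model_minI:
  assumes "u \<in> Om" and "\<And>y. Theta f g A u p \<le> Theta f g A u y"
  shows "model_min A u p"
proof -
  obtain y0 where y0: "y0 \<in> D" using dom_nonempty by blast
  have "Theta f g A u p \<noteq> \<infinity>"
    using assms(2)[of y0] Theta_eq(1)[OF assms(1) y0] by auto
  then have "p \<in> D" using Theta_eq(2)[OF assms(1)] by blast
  moreover have "model A u p \<le> model A u y" if "y \<in> D" for y
    using assms(2)[of y] Theta_eq(1)[OF assms(1) that] Theta_eq(1)[OF assms(1) \<open>p \<in> D\<close>] by simp
  ultimately show ?thesis by (simp add: model_min_def)
qed

text \<open>Exact expansion of the quadratic part around \<open>p\<close>; self-adjointness merges the two mixed terms.\<close>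

lemma model_shift:
  assumes "self_adjoint A"
  shows "model A u (p + h) = model A u p - gr p + gr (p + h)
    + (grad f u + A (p - u)) \<bullet> h + 1 / 2 * (h \<bullet> A h)"
proof -
  have lin: "A (p + h - u) = A (p - u) + A h"
    using assms linear_add[of A "p - u" h] by (simp add: self_adjoint_def algebra_simps)
  have "(p - u) \<bullet> A h = A (p - u) \<bullet> h" using assms by (simp add: self_adjoint_def)
  moreover have "h \<bullet> A (p - u) = A (p - u) \<bullet> h" by (rule inner_commute)
  moreover have "p + h - u = (p - u) + h" by simp
  ultimately show ?thesis
    unfolding model_def lin by (simp add: inner_add_left inner_add_right algebra_simps)
qed

text \<open>Along the segment from \<open>p\<close> to \<open>y\<close>, minimality and convexity of \<open>g\<close> give
  \<open>0 \<le> t * (b + t * c)\<close>, where \<open>b\<close> is the difference of the two sides. Divide by \<open>t\<close> and let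
  \<open>t\<close> tend to 0.\<close>

lemma model_min_first_order:
  assumes "self_adjoint A" "model_min A u p" "y \<in> D"
  shows "gr p - (grad f u + A (p - u)) \<bullet> (y - p) \<le> gr y"
proof -
  let ?w = "y - p"
  let ?b = "(grad f u + A (p - u)) \<bullet> ?w + gr y - gr p"
  let ?c = "1 / 2 * (?w \<bullet> A ?w)"
  have p: "p \<in> D" using assms(2) by (simp add: model_min_def)
  have "0 \<le> ?b + t * ?c" if t: "0 < t" "t < 1" for t :: real
  proof -
    have z: "p + t *\<^sub>R ?w = (1 - t) *\<^sub>R p + t *\<^sub>R y" by (simp add: algebra_simps)
    have "model A u p \<le> model A u (p + t *\<^sub>R ?w)"
      using assms(2) gr_segment(1)[OF p assms(3) t] unfolding z model_min_def by blast
    moreover have "gr (p + t *\<^sub>R ?w) \<le> (1 - t) * gr p + t * gr y"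
      using gr_segment(2)[OF p assms(3) t] unfolding z .
    moreover have "A (t *\<^sub>R ?w) = t *\<^sub>R A ?w"
      using assms(1) by (simp add: self_adjoint_def linear_scale)
    ultimately have "0 \<le> t * (?b + t * ?c)"
      unfolding model_shift[OF assms(1)] by (simp add: algebra_simps)
    then show ?thesis using t by (simp add: zero_le_mult_iff)
  qed
  then have "eventually (\<lambda>t. 0 \<le> ?b + t * ?c) (at_right 0)"
    unfolding eventually_at_right_field by (intro exI[of _ 1]) auto
  moreover have "((\<lambda>t. ?b + t * ?c) \<longlongrightarrow> ?b + 0 * ?c) (at_right 0)"
    by (intro tendsto_intros)
  ultimately have "0 \<le> ?b + 0 * ?c"
    using tendsto_lowerbound trivial_limit_at_right_real by blast
  then show ?thesis by simp
qed

text \<open>The first-order condition removes all terms of the expansion around a minimizer except the quadratic one.\<close>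

lemma model_min_growth:
  assumes "self_adjoint A" "model_min A u p" "y \<in> D"
  shows "model A u p + 1 / 2 * ((y - p) \<bullet> A (y - p)) \<le> model A u y"
  using model_shift[OF assms(1), of u p "y - p"] model_min_first_order[OF assms] by simp

text \<open>The first-order condition is an affine lower bound of \<open>g\<close>. A solvable subproblem therefore replaces the
  separation theorem that would produce a minorant of a general proper lower semicontinuous convex function.\<close>

lemma model_min_imp_affine_minorant:
  assumes "self_adjoint A" "model_min A u p"
  shows "\<exists>a b. \<forall>y\<in>D. a + b \<bullet> y \<le> gr y"
proof -
  let ?b = "- (grad f u + A (p - u))"
  have "(gr p - ?b \<bullet> p) + ?b \<bullet> y \<le> gr y" if "y \<in> D" for y
    using model_min_first_order[OF assms that] by (simp add: inner_diff_right inner_diff_left inner_add_left)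
  then show ?thesis by blast
qed

end

section \<open>The forward-backward step and its envelope\<close>

locale forward_backward = composite_model +
  fixes \<gamma> :: real
  assumes \<gamma>_pos: "\<gamma> > 0"
    and minorant: "\<exists>a b. \<forall>y\<in>effdom g. a + b \<bullet> y \<le> real_of_ereal (g y)"
begin

abbreviation scale :: "'a \<Rightarrow> 'a" where "scale \<equiv> \<lambda>v. (1 / \<gamma>) *\<^sub>R v"

lemma self_adjoint_scale: "self_adjoint scale"
  by (auto simp: self_adjoint_def linear_iff algebra_simps)

lemma model_scale:
  "model scale u y = fr u + grad f u \<bullet> (y - u) + 1 / (2 * \<gamma>) * (norm (y - u))\<^sup>2 + gr y"
  by (simp add: model_def power2_norm_eq_inner)

text \<open>The affine minorant of \<open>g\<close> makes the model grow quadratically, so that it exceeds its value at a fixed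
  \<open>y0 \<in> D\<close> outside a ball; inside, a lower semicontinuous function attains its minimum.\<close>

lemma model_scale_min_exists:
  assumes u: "u \<in> Om"
  shows "\<exists>p. model_min scale u p"
proof -
  obtain a b where minor: "\<And>y. y \<in> D \<Longrightarrow> a + b \<bullet> y \<le> gr y" using minorant by blast
  obtain y0 where y0: "y0 \<in> D" using dom_nonempty by blast
  let ?T = "model scale u y0" and ?c0 = "fr u + a + b \<bullet> u" and ?c1 = "norm (grad f u) + norm b"
  \<comment> \<open>The first entry makes the quadratic term beat the linear one by the norm of y - u,
    the second lets that margin cover the offset to the value at y0, the third puts y0 into the ball.\<close>
  define R where "R = Max {2 * \<gamma> * (?c1 + 1), \<bar>?T - ?c0\<bar>, norm (y0 - u)}"
  have R: "2 * \<gamma> * (?c1 + 1) \<le> R" "\<bar>?T - ?c0\<bar> \<le> R" "norm (y0 - u) \<le> R"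
    by (auto simp: R_def)
  have far: "?T \<le> model scale u y" if y: "y \<in> D" and r: "R \<le> norm (y - u)" for y
  proof -
    let ?r = "norm (y - u)"
    have "- (norm (grad f u) * ?r + norm b * ?r) \<le> grad f u \<bullet> (y - u) + b \<bullet> (y - u)"
      using Cauchy_Schwarz_ineq2[of "grad f u" "y - u"] Cauchy_Schwarz_ineq2[of b "y - u"]
      by (simp add: algebra_simps abs_le_iff)
    moreover have "a + b \<bullet> (y - u) + b \<bullet> u \<le> gr y"
      using minor[OF y] by (simp add: inner_diff_right)
    ultimately have "?c0 - ?c1 * ?r + 1 / (2 * \<gamma>) * ?r\<^sup>2 \<le> model scale u y"
      unfolding model_scale distrib_right by linarith
    moreover have "(?c1 + 1) * ?r \<le> 1 / (2 * \<gamma>) * ?r\<^sup>2"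
    proof -
      have "2 * \<gamma> * (?c1 + 1) * ?r \<le> ?r * ?r"
        using R(1) r by (intro mult_right_mono) auto
      then show ?thesis using \<gamma>_pos by (simp add: field_simps power2_eq_square)
    qed
    moreover have "?T - ?c0 \<le> ?r" using R(2) r by linarith
    ultimately show ?thesis by (simp add: algebra_simps)
  qed
  have "continuous_on UNIV (\<lambda>y. fr u + (grad f u \<bullet> (y - u) + 1 / 2 * ((y - u) \<bullet> scale (y - u))))"
    by (intro continuous_intros)
  from lsc_fun_add_continuous[OF lsc_g this] have "lsc_fun (Theta f g scale u)"
  proof (rule back_subst[where P = lsc_fun])
    obtain c where "f u = ereal c" using f_eq[OF u] by blast
    then show "(\<lambda>y. ereal (fr u + (grad f u \<bullet> (y - u) + 1 / 2 * ((y - u) \<bullet> scale (y - u)))) + g y)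
        = Theta f g scale u"
      by (auto simp: Theta_def fun_eq_iff)
  qed
  moreover have "compact (cball u R)" by simp
  moreover have y0_ball: "y0 \<in> cball u R" using R(3) by (simp add: dist_norm norm_minus_commute)
  ultimately obtain p where p: "p \<in> cball u R"
    "\<And>y. y \<in> cball u R \<Longrightarrow> Theta f g scale u p \<le> Theta f g scale u y"
    using lsc_fun_attains_inf by (metis empty_iff)
  have "Theta f g scale u p \<le> Theta f g scale u y" for y
  proof (cases "y \<in> D \<and> y \<notin> cball u R")
    case True
    then have "?T \<le> model scale u y" by (intro far) (auto simp: dist_norm norm_minus_commute)
    then show ?thesis
      using p(2)[OF y0_ball] True by (simp add: Theta_eq(1)[OF u] y0 order_trans)
  next
    case False
    then show ?thesis using p(2)[of y] Theta_eq(2)[OF u, of y] by fastforce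
  qed
  then show ?thesis using model_minI[OF u] by blast
qed

definition fb_step :: "'a \<Rightarrow> 'a" where "fb_step u = (SOME p. model_min scale u p)"

definition env :: "'a \<Rightarrow> real" where "env u = model scale u (fb_step u)"

lemma fb_step: "u \<in> Om \<Longrightarrow> model_min scale u (fb_step u)"
  unfolding fb_step_def using model_scale_min_exists by (rule someI_ex)

lemma fb_step_dom: "u \<in> Om \<Longrightarrow> fb_step u \<in> D"
  using fb_step by (simp add: model_min_def)

lemma env_le: "u \<in> Om \<Longrightarrow> y \<in> D \<Longrightarrow> env u \<le> model scale u y"
  using fb_step by (simp add: env_def model_min_def)

lemma fb_envelope_eq:
  assumes "u \<in> closure D"
  shows "fb_envelope f g \<gamma> u = ereal (env u)"
proof -
  have u: "u \<in> Om" using assms dom_subset(3) by blast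
  obtain c where c: "f u = ereal c" using f_eq[OF u] by blast
  have "g y + ereal (grad f u \<bullet> (y - u) + 1 / (2 * \<gamma>) * (norm (y - u))\<^sup>2) + f u
      = Theta f g scale u y" for y
    by (cases "g y") (simp_all add: Theta_def c power2_norm_eq_inner)
  then have "fb_envelope f g \<gamma> u = (INF y. Theta f g scale u y)"
    using assms by (simp add: fb_envelope_def)
  also have "\<dots> = ereal (env u)"
  proof (rule antisym)
    show "(INF y. Theta f g scale u y) \<le> ereal (env u)"
      using INF_lower[of "fb_step u" UNIV "Theta f g scale u"]
        Theta_eq(1)[OF u fb_step_dom[OF u], of scale] by (simp add: env_def)
    show "ereal (env u) \<le> (INF y. Theta f g scale u y)"
    proof (rule INF_greatest)
      fix y show "ereal (env u) \<le> Theta f g scale u y"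
        using Theta_eq[OF u, of y scale] env_le[OF u, of y] by (cases "y \<in> D") auto
    qed
  qed
  finally show ?thesis .
qed

text \<open>Add the first-order conditions at the two base points, each tested with the minimizer for the other one. The
  values of \<open>g\<close> cancel and what remains is the nonexpansiveness of the proximal map, applied to the forward
  points \<open>u - \<gamma> * grad f u\<close> and \<open>v - \<gamma> * grad f v\<close>.\<close>

lemma fb_step_lipschitz:
  assumes "u \<in> Om" "v \<in> Om"
  shows "norm (fb_step v - fb_step u) \<le> norm (v - u) + \<gamma> * norm (grad f v - grad f u)"
proof -
  let ?p = "fb_step u" and ?q = "fb_step v"
  let ?w = "?q - ?p"
  note fo = model_min_first_order[OF self_adjoint_scale fb_step]
  have "gr ?p - (grad f u + scale (?p - u)) \<bullet> ?w \<le> gr ?q"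
    using fo[OF assms(1) fb_step_dom[OF assms(2)]] .
  moreover have "gr ?q - (grad f v + scale (?q - v)) \<bullet> (?p - ?q) \<le> gr ?p"
    using fo[OF assms(2) fb_step_dom[OF assms(1)]] .
  moreover have "(grad f v + scale (?q - v)) \<bullet> (?p - ?q) = - ((grad f v + scale (?q - v)) \<bullet> ?w)"
    by (metis inner_minus_right minus_diff_eq)
  ultimately have "(grad f v + scale (?q - v)) \<bullet> ?w \<le> (grad f u + scale (?p - u)) \<bullet> ?w"
    by linarith
  then have "\<gamma> * (grad f v \<bullet> ?w + (1 / \<gamma>) * ((?q - v) \<bullet> ?w))
      \<le> \<gamma> * (grad f u \<bullet> ?w + (1 / \<gamma>) * ((?p - u) \<bullet> ?w))"
    using \<gamma>_pos by (intro mult_left_mono) (simp_all add: inner_add_left)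
  then have "\<gamma> * (grad f v \<bullet> ?w) + (?q - v) \<bullet> ?w \<le> \<gamma> * (grad f u \<bullet> ?w) + (?p - u) \<bullet> ?w"
    using \<gamma>_pos by (simp add: distrib_left)
  moreover have "(?q - v) \<bullet> ?w = ?w \<bullet> ?w + (?p - u) \<bullet> ?w - (v - u) \<bullet> ?w"
    by (simp add: inner_diff_left)
  ultimately have "?w \<bullet> ?w \<le> (v - u) \<bullet> ?w - \<gamma> * ((grad f v - grad f u) \<bullet> ?w)"
    unfolding inner_diff_left[of "grad f v"] right_diff_distrib by linarith
  also have "\<dots> \<le> norm (v - u) * norm ?w + \<gamma> * (norm (grad f v - grad f u) * norm ?w)"
  proof -
    have "\<gamma> * (- ((grad f v - grad f u) \<bullet> ?w)) \<le> \<gamma> * (norm (grad f v - grad f u) * norm ?w)"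
      using Cauchy_Schwarz_ineq2[of "grad f v - grad f u" ?w] \<gamma>_pos
      by (intro mult_left_mono) (auto simp: abs_le_iff)
    then show ?thesis using norm_cauchy_schwarz[of "v - u" ?w] by simp
  qed
  finally have "norm ?w * norm ?w \<le> (norm (v - u) + \<gamma> * norm (grad f v - grad f u)) * norm ?w"
    by (simp add: algebra_simps power2_norm_eq_inner[symmetric] power2_eq_square)
  then show ?thesis
    using \<gamma>_pos by (cases "?w = 0") auto
qed

lemma isCont_fb_step:
  assumes "u \<in> Om"
  shows "isCont fb_step u"
proof -
  have "eventually (\<lambda>v. v \<in> Om) (at u)"
    using open_Om assms by (simp add: eventually_at_in_open')
  then have bound: "eventually (\<lambda>v. norm (fb_step v - fb_step u)
      \<le> norm (v - u) + \<gamma> * norm (grad f v - grad f u)) (at u)"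
    by (rule eventually_mono) (rule fb_step_lipschitz[OF assms])
  have "((\<lambda>v. norm (v - u) + \<gamma> * norm (grad f v - grad f u))
      \<longlongrightarrow> norm (u - u) + \<gamma> * norm (grad f u - grad f u)) (at u)"
    using isCont_grad[OF assms] unfolding isCont_def by (intro tendsto_intros)
  then have lim: "((\<lambda>v. norm (v - u) + \<gamma> * norm (grad f v - grad f u)) \<longlongrightarrow> 0) (at u)"
    by simp
  show ?thesis
    unfolding isCont_def using Lim_null_comparison[OF bound lim] by (rule LIM_zero_cancel)
qed

text \<open>The change of the model value with the base point at a fixed \<open>q\<close> does not involve \<open>g\<close>. This makes the
  envelope regular although \<open>g\<close> is not.\<close>

lemma model_base_change:
  "model scale u q - model scale x q = (fr u - fr x - grad f x \<bullet> (u - x))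
     + (grad f u - grad f x) \<bullet> (q - x) - (grad f u - grad f x) \<bullet> (u - x)
     + (1 / \<gamma>) * ((x - q) \<bullet> (u - x)) + 1 / (2 * \<gamma>) * (norm (u - x))\<^sup>2"
proof -
  have "(norm (q - u))\<^sup>2 = (norm (q - x))\<^sup>2 + 2 * ((x - q) \<bullet> (u - x)) + (norm (u - x))\<^sup>2"
    unfolding power2_norm_eq_inner by (simp add: inner_diff_left inner_diff_right inner_commute)
  then have sq: "1 / (2 * \<gamma>) * (norm (q - u))\<^sup>2 = 1 / (2 * \<gamma>) * (norm (q - x))\<^sup>2
      + (1 / \<gamma>) * ((x - q) \<bullet> (u - x)) + 1 / (2 * \<gamma>) * (norm (u - x))\<^sup>2"
    using \<gamma>_pos by (simp add: field_simps)
  have "grad f u \<bullet> (q - u) - grad f x \<bullet> (q - x) + grad f x \<bullet> (u - x)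
      = (grad f u - grad f x) \<bullet> (q - x) - (grad f u - grad f x) \<bullet> (u - x)"
    by (simp add: inner_diff_left inner_diff_right)
  with sq show ?thesis
    unfolding model_scale by linarith
qed

text \<open>Since \<open>env\<close> is a minimum, \<open>env u - env x\<close> lies between the base changes at \<open>fb_step u\<close> and at
  \<open>fb_step x\<close>, and both tend to 0.\<close>

lemma isCont_env:
  assumes "x \<in> Om"
  shows "isCont env x"
proof -
  define F where "F = fr"
  let ?h = "\<lambda>u q. (F u - F x - grad f x \<bullet> (u - x))
     + (grad f u - grad f x) \<bullet> (q - x) - (grad f u - grad f x) \<bullet> (u - x)
     + (1 / \<gamma>) * ((x - q) \<bullet> (u - x)) + 1 / (2 * \<gamma>) * (norm (u - x))\<^sup>2"
  have h: "model scale u q = model scale x q + ?h u q" for u q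
    using model_base_change[of u q x] unfolding F_def by linarith
  have ev: "eventually (\<lambda>u. u \<in> Om) (at x)"
    using open_Om assms by (simp add: eventually_at_in_open')
  note cont = isCont_grad[OF assms] isCont_fr[OF assms, folded F_def] isCont_fb_step[OF assms]
  have lim: "((\<lambda>u. env x + ?h u (q u)) \<longlongrightarrow> env x + ?h x (q x)) (at x)"
    if "(q \<longlongrightarrow> q x) (at x)" for q
    using cont that unfolding isCont_def by (intro tendsto_intros)
  have lower: "((\<lambda>u. env x + ?h u (fb_step u)) \<longlongrightarrow> env x) (at x)"
    using lim[of fb_step] cont(3) unfolding isCont_def by simp
  have upper: "((\<lambda>u. env x + ?h u (fb_step x)) \<longlongrightarrow> env x) (at x)"
    using lim[of "\<lambda>_. fb_step x"] by simp
  have "eventually (\<lambda>u. env x + ?h u (fb_step u) \<le> env u) (at x)"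
    using ev
  proof eventually_elim
    case (elim u)
    show ?case
      using h[of u "fb_step u"] env_le[OF assms fb_step_dom[OF elim]] unfolding env_def[of u] by linarith
  qed
  moreover have "eventually (\<lambda>u. env u \<le> env x + ?h u (fb_step x)) (at x)"
    using ev
  proof eventually_elim
    case (elim u)
    show ?case
      using h[of u "fb_step x"] env_le[OF elim fb_step_dom[OF assms]] unfolding env_def[of x] by linarith
  qed
  ultimately show ?thesis
    unfolding isCont_def using tendsto_sandwich[OF _ _ lower upper] by blast
qed

text \<open>\<open>(I / \<gamma> - (hess x)\<^sup>T) (x - fb_step x)\<close>, the gradient that the chain rule gives for
  \<open>f(x) - (\<gamma> / 2) * (norm (grad f x))\<^sup>2 + e (x - \<gamma> * grad f x)\<close> with \<open>e\<close> the Moreau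
  envelope of \<open>g\<close>.\<close>

definition env_grad :: "'a \<Rightarrow> 'a" where
  "env_grad x = adjoint (hess x) (fb_step x - x) + (1 / \<gamma>) *\<^sub>R (x - fb_step x)"

text \<open>Only the lower half of differentiability is proved, which is what a regular subgradient needs. Comparing the
  models based at \<open>u\<close> and \<open>x\<close> at the point \<open>fb_step u\<close> bounds \<open>env u - env x\<close> from below by a
  base change; its linear part is \<open>env_grad x\<close> up to replacing \<open>fb_step u\<close> by \<open>fb_step x\<close>, which
  costs \<open>o(norm (u - x))\<close> by continuity of the step.\<close>

lemma env_lower_expansion:
  assumes x: "x \<in> Om" and "e > 0"
  shows "eventually (\<lambda>u. env x + env_grad x \<bullet> (u - x) - e * norm (u - x) \<le> env u) (at x)"
proof -
  let ?H = "blinfun_apply (hess x)" and ?p = "fb_step x" and ?K = "norm (hess x)"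
  let ?M = "3 + norm (?p - x) + 2 * ?K + 1 / \<gamma>"
  have M: "?M > 0" using \<gamma>_pos by (simp add: add_pos_nonneg)
  \<comment> \<open>The five error terms below add up to c * M * norm (u - x), once c is at most 1.\<close>
  define c where "c = min 1 (e / ?M)"
  have "c \<le> e / ?M" by (simp add: c_def)
  then have c: "0 < c" "c \<le> 1" "c * ?M \<le> e"
    using \<open>e > 0\<close> M divide_pos_pos[OF _ M] unfolding pos_le_divide_eq[OF M] by (auto simp: c_def)
  have "eventually (\<lambda>u. norm (fr u - fr x - grad f x \<bullet> (u - x)) \<le> c * norm (u - x)) (at x)"
    using fr_has_derivative[OF x] \<open>0 < c\<close> unfolding has_derivative_within_alt2 by blast
  moreover have "eventually (\<lambda>u. norm (grad f u - grad f x - ?H (u - x)) \<le> c * norm (u - x)) (at x)"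
    using hess(2)[OF x] \<open>0 < c\<close> unfolding has_derivative_within_alt2 by blast
  moreover have "eventually (\<lambda>u. dist (fb_step u) ?p < c) (at x)"
    using isCont_fb_step[OF x] \<open>0 < c\<close> unfolding isCont_def by (rule tendstoD)
  moreover have "eventually (\<lambda>u. dist u x < c) (at x)"
    using tendsto_ident_at \<open>0 < c\<close> by (rule tendstoD)
  moreover have "eventually (\<lambda>u. u \<in> Om) (at x)"
    using open_Om x by (simp add: eventually_at_in_open')
  ultimately show ?thesis
  proof eventually_elim
    case (elim u)
    let ?q = "fb_step u" and ?s = "norm (u - x)"
    define R where "R = grad f u - grad f x - ?H (u - x)"
    have R: "norm R \<le> c * ?s" and qp: "norm (?q - ?p) \<le> c" and s: "?s \<le> c"
      using elim by (auto simp: R_def dist_norm)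
    have gdiff: "grad f u - grad f x = R + ?H (u - x)" by (simp add: R_def)
    have Hs: "norm (?H (u - x)) \<le> ?K * ?s" by (rule norm_blinfun)
    have t1: "- (c * ?s) \<le> fr u - fr x - grad f x \<bullet> (u - x)" using elim(1) by (simp add: abs_le_iff)
    have inner_ge: "- (a * b) \<le> v \<bullet> w" if "norm v \<le> a" "norm w \<le> b" for v w :: 'a and a b
    proof -
      have "norm v * norm w \<le> a * b" using that by (intro mult_mono) (auto intro: order_trans[OF norm_ge_zero])
      then show ?thesis using Cauchy_Schwarz_ineq2[of v w] by linarith
    qed
    have "norm (?q - x) \<le> norm (?p - x) + 1"
      using norm_triangle_ineq[of "?q - ?p" "?p - x"] qp c(2) by simp
    then have t2: "- (c * ?s * (norm (?p - x) + 1)) \<le> R \<bullet> (?q - x)" by (rule inner_ge[OF R])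
    have t3: "- (?K * ?s * c) \<le> ?H (u - x) \<bullet> (?q - ?p)" by (rule inner_ge[OF Hs qp])
    have "norm (- (R + ?H (u - x))) \<le> (1 + ?K) * ?s"
    proof -
      have "c * ?s \<le> 1 * ?s" using c(2) by (intro mult_right_mono) auto
      then show ?thesis
        unfolding norm_minus_cancel distrib_right using norm_triangle_ineq[of R "?H (u - x)"] R Hs by linarith
    qed
    from inner_ge[OF this s] have t4: "- ((1 + ?K) * ?s * c) \<le> - ((R + ?H (u - x)) \<bullet> (u - x))"
      by (simp only: inner_minus_left)
    have "norm (?p - ?q) \<le> c" using qp by (simp add: norm_minus_commute)
    from inner_ge[OF this order_refl] have *: "- (c * ?s) \<le> (?p - ?q) \<bullet> (u - x)" .
    have "0 \<le> 1 / \<gamma>" using \<gamma>_pos by simp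
    from mult_left_mono[OF * this]
    have t5: "- ((1 / \<gamma>) * (c * ?s)) \<le> (1 / \<gamma>) * ((?p - ?q) \<bullet> (u - x))"
      by (simp only: mult_minus_right)
    have adj: "env_grad x \<bullet> (u - x) = ?H (u - x) \<bullet> (?p - x) + (1 / \<gamma>) * ((x - ?p) \<bullet> (u - x))"
      using adjoint_works[OF bounded_linear.linear[OF blinfun.bounded_linear_right], of "u - x" "hess x" "?p - x"]
      unfolding env_grad_def inner_add_left inner_scaleR_left inner_commute[of "u - x"] by simp
    have "(x - ?q) \<bullet> (u - x) = (x - ?p) \<bullet> (u - x) + (?p - ?q) \<bullet> (u - x)"
      by (simp add: inner_diff_left)
    then have split: "(R + ?H (u - x)) \<bullet> (?q - x) = R \<bullet> (?q - x) + ?H (u - x) \<bullet> (?q - ?p) + ?H (u - x) \<bullet> (?p - x)"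
      "(1 / \<gamma>) * ((x - ?q) \<bullet> (u - x)) = (1 / \<gamma>) * ((x - ?p) \<bullet> (u - x)) + (1 / \<gamma>) * ((?p - ?q) \<bullet> (u - x))"
      by (simp add: inner_add_left inner_diff_right, simp only: distrib_left)
    have sum: "c * ?s + c * ?s * (norm (?p - x) + 1) + ?K * ?s * c + (1 + ?K) * ?s * c + (1 / \<gamma>) * (c * ?s)
        = (c * ?M) * ?s"
      by (simp add: algebra_simps)
    have t6: "0 \<le> 1 / (2 * \<gamma>) * ?s\<^sup>2" using \<gamma>_pos by simp
    have "(c * ?M) * ?s \<le> e * ?s" using c(3) by (intro mult_right_mono) auto
    with sum have total: "c * ?s + c * ?s * (norm (?p - x) + 1) + ?K * ?s * c + (1 + ?K) * ?s * c
        + (1 / \<gamma>) * (c * ?s) \<le> e * ?s"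
      by (rule ord_eq_le_trans)
    have arith: "h + b - E \<le> T1 + (T2 + T3 + h) - T4 + (b + T5) + T6"
      if "- a1 \<le> T1" "- a2 \<le> T2" "- a3 \<le> T3" "- a4 \<le> - T4" "- a5 \<le> T5" "0 \<le> T6"
        "a1 + a2 + a3 + a4 + a5 \<le> E"
      for h b E T1 T2 T3 T4 T5 T6 a1 a2 a3 a4 a5 :: real
      using that by linarith
    have "env_grad x \<bullet> (u - x) - e * ?s \<le> model scale u ?q - model scale x ?q"
      unfolding model_base_change gdiff split adj by (rule arith[OF t1 t2 t3 t4 t5 t6 total])
    moreover have "env x \<le> model scale x ?q" using env_le[OF x fb_step_dom[OF elim(5)]] .
    ultimately show ?case unfolding env_def[of u] by linarith
  qed
qed

lemma norm_env_grad_le: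
  "norm (env_grad x) \<le> (norm (hess x) + 1 / \<gamma>) * norm (x - fb_step x)"
proof -
  let ?H = "blinfun_apply (hess x)"
  let ?w = "fb_step x - x"
  let ?a = "adjoint ?H ?w"
  have "?a \<bullet> ?a = ?H ?a \<bullet> ?w"
    by (rule adjoint_works) (rule bounded_linear.linear[OF blinfun.bounded_linear_right])
  also have "\<dots> \<le> norm (?H ?a) * norm ?w" by (rule norm_cauchy_schwarz)
  also have "\<dots> \<le> (norm (hess x) * norm ?a) * norm ?w"
    by (intro mult_right_mono norm_blinfun) auto
  finally have "norm ?a * norm ?a \<le> (norm (hess x) * norm ?w) * norm ?a"
    by (simp add: power2_norm_eq_inner[symmetric] power2_eq_square mult_ac)
  then have "norm ?a \<le> norm (hess x) * norm ?w"
    using mult_right_le_imp_le[of "norm ?a" "norm ?a"] by (cases "?a = 0") auto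
  then show ?thesis
    using norm_triangle_ineq[of ?a "(1 / \<gamma>) *\<^sub>R (x - fb_step x)"] \<gamma>_pos
    by (simp add: env_grad_def norm_minus_commute distrib_right)
qed

text \<open>The terms added to the envelope are convex quadratics, which lie above their linearizations. Outside the closed
  domain of \<open>g\<close> the value \<open>\<infinity>\<close> makes the inequality trivial, so boundary points need no extra care.\<close>

lemma Phi_regular_subgradient:
  assumes x: "x \<in> closure D" and "L \<ge> 0"
  shows "(env_grad x + L *\<^sub>R (x - y), L *\<^sub>R (y - x), 2 * t) \<in> regular_subdiff (Phi f g L \<gamma>) (x, y, t)"
proof (rule regular_subdiffI)
  let ?z = "(x, y, t)" and ?v = "(env_grad x + L *\<^sub>R (x - y), L *\<^sub>R (y - x), 2 * t)"
  have Phi_eq: "Phi f g L \<gamma> (u, y', s) = ereal (env u + L / 2 * (norm (y' - u))\<^sup>2 + s\<^sup>2)"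
    if "u \<in> closure D" for u y' s
    using fb_envelope_eq[OF that] by (simp add: Phi_def)
  show "\<bar>Phi f g L \<gamma> ?z\<bar> \<noteq> \<infinity>" by (simp add: Phi_eq[OF x])
  fix e :: real assume "e > 0"
  have xOm: "x \<in> Om" using x by (rule dom_subset(3))
  have "eventually (\<lambda>u. env x + env_grad x \<bullet> (u - x) - e * norm (u - x) \<le> env u) (nhds x)"
    using env_lower_expansion[OF xOm \<open>e > 0\<close>] by (auto simp: eventually_at_filter elim!: eventually_mono)
  moreover have "filterlim fst (nhds x) (at ?z)"
    using tendsto_fst[OF tendsto_ident_at[of ?z UNIV]] by simp
  ultimately have "eventually (\<lambda>z. env x + env_grad x \<bullet> (fst z - x) - e * norm (fst z - x) \<le> env (fst z)) (at ?z)"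
    by (rule eventually_compose_filterlim)
  then show "eventually (\<lambda>z. Phi f g L \<gamma> ?z + ereal (?v \<bullet> (z - ?z) - e * norm (z - ?z)) \<le> Phi f g L \<gamma> z) (at ?z)"
  proof eventually_elim
    case (elim z)
    obtain u y' s where z: "z = (u, y', s)" by (cases z)
    show ?case
    proof (cases "u \<in> closure D")
      case True
      have "norm (u - x) \<le> norm (z - ?z)"
        using norm_fst_le[of "u - x" "(y' - y, s - t)"] by (simp add: z)
      then have "e * norm (u - x) \<le> e * norm (z - ?z)" using \<open>e > 0\<close> by simp
      then have 1: "env x + env_grad x \<bullet> (u - x) - e * norm (z - ?z) \<le> env u"
        using elim by (simp add: z)
      have 2: "L / 2 * (norm (y - x))\<^sup>2 + (L *\<^sub>R (x - y)) \<bullet> (u - x) + (L *\<^sub>R (y - x)) \<bullet> (y' - y)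
          \<le> L / 2 * (norm (y' - u))\<^sup>2"
      proof -
        have "L / 2 * (norm (y' - u))\<^sup>2 - L / 2 * (norm (y - x))\<^sup>2 - (L *\<^sub>R (x - y)) \<bullet> (u - x)
            - (L *\<^sub>R (y - x)) \<bullet> (y' - y) = L / 2 * (norm ((y' - u) - (y - x)))\<^sup>2"
          unfolding power2_norm_eq_inner
          by (simp add: inner_diff_left inner_diff_right inner_commute algebra_simps)
        also have "\<dots> \<ge> 0" using \<open>L \<ge> 0\<close> by simp
        finally show ?thesis by linarith
      qed
      have 3: "t\<^sup>2 + 2 * t * (s - t) \<le> s\<^sup>2"
        using zero_le_power2[of "s - t"] by (simp add: power2_eq_square algebra_simps)
      have "?v \<bullet> (z - ?z) = env_grad x \<bullet> (u - x) + (L *\<^sub>R (x - y)) \<bullet> (u - x)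
          + (L *\<^sub>R (y - x)) \<bullet> (y' - y) + 2 * t * (s - t)"
        by (simp add: z inner_add_left)
      then show ?thesis
        unfolding z Phi_eq[OF x] Phi_eq[OF True] using 1 2 3 by (simp add: z)
    next
      case False
      then show ?thesis by (simp add: z Phi_def fb_envelope_def)
    qed
  qed
qed

text \<open>Test the first-order conditions of the minimizers for the metrics \<open>I / \<gamma>\<close> and \<open>A\<close> with each other
  and add. With \<open>a = fb_step u - u\<close> and \<open>b = p - u\<close> the result is
  \<open>(norm a)\<^sup>2 \<le> \<langle>a, b\<rangle> + \<gamma> * \<langle>A b, a\<rangle>\<close>; the term \<open>\<langle>A b, b\<rangle> \<ge> 0\<close> is dropped.\<close>

lemma norm_forward_backward_residual_le:
  assumes u: "u \<in> Om" and A: "self_adjoint A" "model_min A u p"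
    and A_psd: "\<And>h. 0 \<le> h \<bullet> A h" and A_bound: "\<And>h. norm (A h) \<le> M * norm h"
  shows "norm (fb_step u - u) \<le> (1 + \<gamma> * M) * norm (p - u)"
proof -
  let ?a = "fb_step u - u" and ?b = "p - u"
  have dom: "p \<in> D" "fb_step u \<in> D" using A(2) fb_step_dom[OF u] by (auto simp: model_min_def)
  have "gr (fb_step u) - (grad f u + scale ?a) \<bullet> (?b - ?a) \<le> gr p"
    using model_min_first_order[OF self_adjoint_scale fb_step[OF u] dom(1)] by simp
  moreover have "gr p - (grad f u + A ?b) \<bullet> (?a - ?b) \<le> gr (fb_step u)"
    using model_min_first_order[OF A dom(2)] by simp
  ultimately have "(grad f u + scale ?a) \<bullet> (?b - ?a) + (grad f u + A ?b) \<bullet> (?a - ?b) \<ge> 0"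
    by linarith
  then have "(1 / \<gamma>) * (?a \<bullet> ?a) \<le> (1 / \<gamma>) * (?a \<bullet> ?b) + A ?b \<bullet> ?a - A ?b \<bullet> ?b"
    unfolding inner_add_left inner_diff_right[of _ ?a] inner_diff_right[of _ ?b] inner_scaleR_left
      right_diff_distrib by linarith
  then have "\<gamma> * ((1 / \<gamma>) * (?a \<bullet> ?a)) \<le> \<gamma> * ((1 / \<gamma>) * (?a \<bullet> ?b) + A ?b \<bullet> ?a)"
    using A_psd[of ?b] \<gamma>_pos by (intro mult_left_mono) (auto simp: inner_commute)
  then have "?a \<bullet> ?a \<le> ?a \<bullet> ?b + \<gamma> * (A ?b \<bullet> ?a)"
    using \<gamma>_pos by (simp add: distrib_left)
  also have "\<dots> \<le> norm ?a * norm ?b + \<gamma> * ((M * norm ?b) * norm ?a)"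
  proof (intro add_mono mult_left_mono)
    show "A ?b \<bullet> ?a \<le> (M * norm ?b) * norm ?a"
      using norm_cauchy_schwarz[of "A ?b" ?a] mult_right_mono[OF A_bound[of ?b] norm_ge_zero[of ?a]]
      by linarith
  qed (use \<gamma>_pos norm_cauchy_schwarz in auto)
  finally have "norm ?a * norm ?a \<le> ((1 + \<gamma> * M) * norm ?b) * norm ?a"
    by (simp add: power2_norm_eq_inner[symmetric] power2_eq_square algebra_simps)
  moreover have "0 \<le> (1 + \<gamma> * M) * norm ?b"
  proof (cases "?b = 0")
    case False
    have "0 \<le> M * norm ?b" using A_bound[of ?b] norm_ge_zero order_trans by blast
    then have "0 \<le> M" using False by (simp add: zero_le_mult_iff)
    then show ?thesis using \<gamma>_pos by simp
  qed simp
  ultimately show ?thesis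
    using mult_right_le_imp_le[of "norm ?a" "norm ?a"] by (cases "?a = 0") auto
qed

lemma model_min_le_env:
  assumes "u \<in> Om" "model_min A u p" and "\<And>h. h \<bullet> A h \<le> 1 / \<gamma> * (norm h)\<^sup>2"
  shows "model A u p \<le> env u"
proof -
  have "model A u p \<le> model A u (fb_step u)"
    using assms(2) fb_step_dom[OF assms(1)] by (simp add: model_min_def)
  also have "\<dots> \<le> env u"
    using assms(3)[of "fb_step u - u"] by (simp add: model_def env_def power2_norm_eq_inner)
  finally show ?thesis .
qed

text \<open>At a fixed point the metric term of the first-order condition vanishes, and the condition says that
  \<open>- grad f u\<close> is a convex subgradient of \<open>g\<close>.\<close>

lemma fb_step_fixed_point_stationary:
  assumes u: "u \<in> Om" and fixed: "fb_step u = u"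
  shows "u \<in> stationary_points f g"
proof -
  have uD: "u \<in> D" using fb_step_dom[OF u] fixed by simp
  have ineq: "gr u - grad f u \<bullet> (y - u) \<le> gr y" if "y \<in> D" for y
    using model_min_first_order[OF self_adjoint_scale fb_step[OF u] that] fixed by simp
  obtain c where c: "g u = ereal c" using g_eq(1)[OF uD] by blast
  have "- grad f u \<in> regular_subdiff g u"
  proof (rule regular_subdiffI)
    show "\<bar>g u\<bar> \<noteq> \<infinity>" using c by simp
    fix e :: real assume "e > 0"
    have "g u + ereal (- grad f u \<bullet> (y - u) - e * norm (y - u)) \<le> g y" for y
    proof (cases "y \<in> D")
      case True
      obtain b where "g y = ereal b" using g_eq(1)[OF True] by blast
      moreover have "0 \<le> e * norm (y - u)" using \<open>e > 0\<close> by simp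
      ultimately show ?thesis using ineq[OF True] c by simp
    next
      case False
      then show ?thesis using g_eq(2) by simp
    qed
    then show "eventually (\<lambda>y. g u + ereal (- grad f u \<bullet> (y - u) - e * norm (y - u)) \<le> g y) (at u)"
      by simp
  qed
  then have "- grad f u \<in> limiting_subdiff g u"
    using regular_subdiff_subset_limiting by blast
  then show ?thesis unfolding stationary_points_def by force
qed

end

section \<open>One iteration of the method\<close>

context composite_model
begin

definition objective :: "'a \<Rightarrow> real" where "objective x = fr x + gr x"

lemma objective_eq: "x \<in> D \<Longrightarrow> f x + g x = ereal (objective x)"
proof -
  assume x: "x \<in> D"
  obtain a b where "f x = ereal a" "g x = ereal b"
    using f_eq[OF dom_subset(1)[OF x]] g_eq(1)[OF x] by blast
  then show ?thesis by (simp add: objective_def)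
qed

lemma model_self: "self_adjoint A \<Longrightarrow> model A u u = objective u"
  by (simp add: model_def objective_def self_adjoint_def linear_0)

lemma VMiPG_step_inexact_minimizer:
  assumes "VMiPG_step f g \<mu> \<beta> \<sigma> e A u y u'" and u: "u \<in> D"
  shows "self_adjoint A" "\<mu> * (norm h)\<^sup>2 \<le> h \<bullet> A h"
    "y \<in> D" "y \<noteq> u" "model A u y < objective u"
    "\<exists>p. model_min A u p \<and> model A u y \<le> model A u p + e * (norm (y - u))\<^sup>2"
proof -
  have A: "self_adjoint A" and ge: "op_ge A (\<lambda>x. \<mu> *\<^sub>R x)"
    and less: "Theta f g A u y < Theta f g A u u"
    and "\<exists>p. is_unique_minimizer (Theta f g A u) p
      \<and> Theta f g A u y - Theta f g A u p \<le> ereal (e * (norm (y - u))\<^sup>2)"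
    using assms(1) unfolding VMiPG_step_def by blast+
  then obtain p where p: "is_unique_minimizer (Theta f g A u) p"
    "Theta f g A u y - Theta f g A u p \<le> ereal (e * (norm (y - u))\<^sup>2)" by blast
  note Theta = Theta_eq[OF dom_subset(1)[OF u]]
  show "self_adjoint A" by (rule A)
  show "\<mu> * (norm h)\<^sup>2 \<le> h \<bullet> A h"
    using ge unfolding op_ge_def by (auto simp: inner_diff_right power2_norm_eq_inner)
  show y: "y \<in> D" using less Theta(2)[of y A] by fastforce
  show "y \<noteq> u" using less by blast
  show "model A u y < objective u"
    using less Theta(1)[OF y] Theta(1)[OF u] by (simp add: model_self[OF A])
  have min: "model_min A u p"
  proof (rule model_minI[OF dom_subset(1)[OF u]])
    fix z show "Theta f g A u p \<le> Theta f g A u z"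
      using p(1) less_imp_le unfolding is_unique_minimizer_def by (cases "z = p") auto
  qed
  then have "p \<in> D" by (simp add: model_min_def)
  then have "model A u y \<le> model A u p + e * (norm (y - u))\<^sup>2"
    using p(2) Theta(1)[OF y] Theta(1) by simp
  with min show "\<exists>p. model_min A u p \<and> model A u y \<le> model A u p + e * (norm (y - u))\<^sup>2"
    by blast
qed

text \<open>The strict decrease of the model bounds the directional part of \<open>F\<close> by \<open>- \<mu> / 2 * (norm (y - u))\<^sup>2\<close>, and
  the descent lemma costs \<open>L / 2 * t\<^sup>2 * (norm (y - u))\<^sup>2\<close>. So every \<open>t \<le> (\<mu> - 2 * \<sigma>) / L\<close> satisfies the
  line-search test, and backtracking overshoots this threshold by at most one factor \<open>\<beta>\<close>. Whichever point
  is chosen last, its value is at most that of \<open>y\<close> and at most that of the line-search point.\<close>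

lemma VMiPG_step_descent:
  assumes step: "VMiPG_step f g \<mu> \<beta> \<sigma> e A u y u'" and u: "u \<in> D"
    and par: "0 < \<beta>" "\<beta> < 1" "0 < \<sigma>" "\<sigma> < 1 / 2 * \<mu>"
    and S: "L > 0" "L-lipschitz_on S (grad f)" "convex S" "S \<subseteq> Om" "u \<in> S" "y \<in> S"
  shows "u' \<in> D" "objective u' \<le> objective y" "norm (u' - u) \<le> norm (y - u)"
    "\<sigma> * min 1 (\<beta> * ((\<mu> - 2 * \<sigma>) / L)) * (norm (y - u))\<^sup>2 \<le> objective u - objective u'"
proof -
  note inexact = VMiPG_step_inexact_minimizer[OF step u]
  let ?d = "y - u" and ?\<tau> = "(\<mu> - 2 * \<sigma>) / L"
  let ?F = "\<lambda>x. f x + g x"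
  have seg: "u + t *\<^sub>R ?d \<in> D \<and> gr (u + t *\<^sub>R ?d) \<le> (1 - t) * gr u + t * gr y \<and> u + t *\<^sub>R ?d \<in> S"
    if "0 < t" "t \<le> 1" for t
  proof (cases "t = 1")
    case True
    then show ?thesis using inexact(3) S(6) by simp
  next
    case False
    have z: "u + t *\<^sub>R ?d = (1 - t) *\<^sub>R u + t *\<^sub>R y" by (simp add: algebra_simps)
    have "t < 1" using False that by simp
    then show ?thesis
      unfolding z using gr_segment[OF u inexact(3) that(1)] convexD_alt[OF S(3,5,6), of t] that by simp
  qed
  have power: "0 < \<beta> ^ m" "\<beta> ^ m \<le> 1" for m using par by (auto intro: power_le_one)
  have suff: "sufficient_decrease ?F \<beta> \<sigma> u ?d m \<longleftrightarrow>
      \<sigma> * \<beta> ^ m * (norm ?d)\<^sup>2 \<le> objective u - objective (u + \<beta> ^ m *\<^sub>R ?d)" for m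
    using seg[OF power, of m] by (simp add: sufficient_decrease_def objective_eq u)
  have short: "\<sigma> * t * (norm ?d)\<^sup>2 \<le> objective u - objective (u + t *\<^sub>R ?d)"
    if t: "0 < t" "t \<le> 1" "t \<le> ?\<tau>" for t
  proof -
    define n where "n = (norm ?d)\<^sup>2"
    have "fr (u + t *\<^sub>R ?d) \<le> fr u + t * (grad f u \<bullet> ?d) + L / 2 * (t\<^sup>2 * n)"
      using descent[OF S(2,3,4,5), of "u + t *\<^sub>R ?d"] seg[OF t(1,2)]
      by (simp add: n_def power_mult_distrib)
    moreover have "gr (u + t *\<^sub>R ?d) \<le> (1 - t) * gr u + t * gr y"
      using seg[OF t(1,2)] by blast
    moreover have "t * (grad f u \<bullet> ?d + gr y - gr u) = t * (grad f u \<bullet> ?d) + t * gr y - t * gr u"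
      by (simp only: distrib_left right_diff_distrib)
    ultimately have "objective (u + t *\<^sub>R ?d)
        \<le> objective u + t * (grad f u \<bullet> ?d + gr y - gr u) + L / 2 * (t\<^sup>2 * n)"
      unfolding objective_def left_diff_distrib by linarith
    moreover have "grad f u \<bullet> ?d + gr y - gr u \<le> - (\<mu> / 2 * n)"
      using inexact(5) inexact(2)[of ?d] by (simp add: model_def objective_def n_def)
    then have "t * (grad f u \<bullet> ?d + gr y - gr u) \<le> t * (- (\<mu> / 2 * n))"
      using t(1) by (intro mult_left_mono) auto
    moreover have "t * n * (L * t / 2) \<le> t * n * ((\<mu> - 2 * \<sigma>) / 2)"
      using t S(1) by (intro mult_left_mono) (auto simp: n_def pos_le_divide_eq mult.commute)
    moreover have "L / 2 * (t\<^sup>2 * n) = t * n * (L * t / 2)" by (simp add: power2_eq_square)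
    moreover have "t * n * ((\<mu> - 2 * \<sigma>) / 2) = - (t * (- (\<mu> / 2 * n))) - \<sigma> * t * n"
      by (simp add: algebra_simps diff_divide_distrib)
    ultimately show ?thesis unfolding n_def[symmetric] by linarith
  qed
  obtain m where m: "sufficient_decrease ?F \<beta> \<sigma> u ?d m"
    "\<And>j. j < m \<Longrightarrow> \<not> sufficient_decrease ?F \<beta> \<sigma> u ?d j"
    and u': "let v = u + \<beta> ^ m *\<^sub>R ?d in u' = (if ?F y < ?F v then y else v)"
    using step unfolding VMiPG_step_def by blast
  define v where "v = u + \<beta> ^ m *\<^sub>R ?d"
  have v: "v \<in> D" using seg[OF power, of m] by (simp add: v_def)
  have u'_eq: "u' = (if objective y < objective v then y else v)"
    using u' by (simp add: v_def[symmetric] objective_eq inexact(3) v)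
  then show "u' \<in> D" using v inexact(3) by simp
  show "objective u' \<le> objective y" using u'_eq by auto
  have "norm (v - u) \<le> norm ?d" using power[of m] by (simp add: v_def mult_left_le_one_le)
  then show "norm (u' - u) \<le> norm ?d" using u'_eq by auto
  have "min 1 (\<beta> * ?\<tau>) \<le> \<beta> ^ m"
  proof (cases m)
    case (Suc j)
    then have "\<not> \<beta> ^ j \<le> ?\<tau>" using m(2)[of j] short[OF power, of j] by (auto simp: suff)
    then have "\<beta> * ?\<tau> \<le> \<beta> * \<beta> ^ j" using par(1) by (intro mult_left_mono) auto
    then show ?thesis using Suc by simp
  qed simp
  then have "\<sigma> * min 1 (\<beta> * ?\<tau>) * (norm ?d)\<^sup>2 \<le> \<sigma> * \<beta> ^ m * (norm ?d)\<^sup>2"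
    using par(3) by (intro mult_right_mono mult_left_mono) auto
  also have "\<dots> \<le> objective u - objective v" using m(1) by (simp add: suff v_def)
  also have "\<dots> \<le> objective u - objective u'" using u'_eq by auto
  finally show "\<sigma> * min 1 (\<beta> * ?\<tau>) * (norm ?d)\<^sup>2 \<le> objective u - objective u'" .
qed

end

context forward_backward
begin

lemma env_le_objective: "u \<in> D \<Longrightarrow> env u \<le> objective u"
  using env_le[of u u] by (simp add: dom_subset(1) model_self[OF self_adjoint_scale])

text \<open>With \<open>e \<le> \<mu> / 10\<close>, quadratic growth gives \<open>(norm (y - p))\<^sup>2 \<le> (norm (y - u))\<^sup>2 / 5\<close>, hence
  \<open>norm (p - u) \<le> 2 * norm (y - u)\<close>; comparing metrics costs another factor \<open>1 + \<gamma> * M \<le> 2\<close>, which makes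
  4. In the second claim the quadratic term of the model, at least \<open>\<mu> / 2 * (norm (y - u))\<^sup>2\<close>, absorbs the
  inexactness.\<close>

lemma inexact_minimizer_bounds:
  assumes u: "u \<in> Om" and A: "self_adjoint A" and "\<mu> > 0" and A_lower: "\<And>h. \<mu> * (norm h)\<^sup>2 \<le> h \<bullet> A h"
    and A_upper: "\<And>h. norm (A h) \<le> M * norm h" and M: "\<gamma> * M \<le> 1"
    and p: "model_min A u p" and y: "y \<in> D" and inexact: "model A u y \<le> model A u p + e * (norm (y - u))\<^sup>2"
    and e: "e \<le> \<mu> / 10"
  shows residual_le: "norm (u - fb_step u) \<le> 4 * norm (y - u)"
    and upper_model_le: "fr u + grad f u \<bullet> (y - u) + gr y \<le> env u"
proof -
  let ?d = "y - u"
  have psd: "0 \<le> h \<bullet> A h" for h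
  proof -
    have "0 \<le> \<mu> * (norm h)\<^sup>2" using \<open>\<mu> > 0\<close> by simp
    then show ?thesis using A_lower[of h] by linarith
  qed
  have e_d: "e * (norm ?d)\<^sup>2 \<le> \<mu> / 10 * (norm ?d)\<^sup>2" using e by (intro mult_right_mono) auto
  have "1 / 2 * ((y - p) \<bullet> A (y - p)) \<le> \<mu> / 10 * (norm ?d)\<^sup>2"
    using model_min_growth[OF A p y] inexact e_d by linarith
  then have "\<mu> * (norm (y - p))\<^sup>2 \<le> \<mu> * ((norm ?d)\<^sup>2 / 5)"
    using A_lower[of "y - p"] by simp
  then have "(norm (y - p))\<^sup>2 \<le> (norm ?d)\<^sup>2 / 5" using \<open>\<mu> > 0\<close> by simp
  then have "(norm (y - p))\<^sup>2 \<le> (norm ?d)\<^sup>2" using zero_le_power2[of "norm ?d"] by linarith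
  then have "norm (y - p) \<le> norm ?d" by (rule power2_le_imp_le) simp
  then have pu: "norm (p - u) \<le> 2 * norm ?d"
    using norm_triangle_ineq[of "p - y" "y - u"] by (simp add: norm_minus_commute)
  have "norm (fb_step u - u) \<le> (1 + \<gamma> * M) * norm (p - u)"
    by (rule norm_forward_backward_residual_le[OF u A p psd A_upper])
  also have "\<dots> \<le> 2 * norm (p - u)" using M by (intro mult_right_mono) auto
  finally show "norm (u - fb_step u) \<le> 4 * norm ?d" using pu by (simp add: norm_minus_commute)
  have "h \<bullet> A h \<le> 1 / \<gamma> * (norm h)\<^sup>2" for h
  proof -
    have "h \<bullet> A h \<le> norm h * (M * norm h)"
      using norm_cauchy_schwarz[of h "A h"] mult_left_mono[OF A_upper[of h] norm_ge_zero[of h]] by linarith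
    also have "\<dots> = M * (norm h)\<^sup>2" by (simp add: power2_eq_square)
    also have "\<dots> \<le> 1 / \<gamma> * (norm h)\<^sup>2"
      using M \<gamma>_pos by (intro mult_right_mono) (auto simp: field_simps)
    finally show ?thesis .
  qed
  from model_min_le_env[OF u p this] have "model A u p \<le> env u" .
  moreover have "model A u y = fr u + grad f u \<bullet> ?d + 1 / 2 * (?d \<bullet> A ?d) + gr y"
    by (simp add: model_def)
  moreover have "0 \<le> \<mu> * (norm ?d)\<^sup>2" using \<open>\<mu> > 0\<close> by simp
  ultimately show "fr u + grad f u \<bullet> ?d + gr y \<le> env u"
    using inexact e_d A_lower[of ?d] by linarith
qed

end

section \<open>Convergence of the method\<close>

theorem theorem1:
  fixes f g :: "'a::euclidean_space \<Rightarrow> ereal"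
    and Om \<Gamma> :: "'a set"
    and \<mu> \<mu>' \<beta> \<sigma> L \<gamma> :: real
    and \<epsilon> :: "nat \<Rightarrow> real"
    and G :: "nat \<Rightarrow> 'a \<Rightarrow> 'a"
    and x y :: "nat \<Rightarrow> 'a"
  assumes "proper_fun f" and "proper_fun g"
    and "lsc_fun g" and "convex_fun g" and "continuous_on (effdom g) g"
    and "lsc_fun f" and "open Om" and "closure (effdom g) \<subseteq> Om" and "twice_cont_diff_on f Om"
    and "(INF u. f u + g u) > -\<infinity>"
    and "VMiPG f g \<mu> \<beta> \<sigma> \<epsilon> G x y"
    and "bounded (range x)"
    and "\<mu>' > 0" and "\<And>k. onorm (G k) \<le> \<mu>'"
    and "compact \<Gamma>" and "convex \<Gamma>" and "range x \<union> range y \<subseteq> \<Gamma>" and "\<Gamma> \<subseteq> Om"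
    and "L > 0" and "L-lipschitz_on \<Gamma> (grad f)"
    and "0 < \<gamma>" and "\<gamma> \<le> 1 / \<mu>'"
    and "KL_function_on Zspace (Phi f g L \<gamma>)"
  shows "summable (\<lambda>k. norm (x (Suc k) - x k)) \<and>
         (\<exists>xb\<in>stationary_points f g. x \<longlonglongrightarrow> xb)"
proof -
  interpret composite_model f g Om
    using assms(2-4,7-9) by unfold_locales
  have par: "0 < \<mu>" "0 < \<beta>" "\<beta> < 1" "0 < \<sigma>" "\<sigma> < 1 / 2 * \<mu>"
    and x0: "x 0 \<in> D"
    and step: "VMiPG_step f g \<mu> \<beta> \<sigma> (\<epsilon> k) (G k) (x k) (y k) (x (Suc k))" for k
    using assms(11) unfolding VMiPG_def by (auto simp: min_def split: if_splits)
  obtain kb where kb: "\<And>k. k \<ge> kb \<Longrightarrow> \<epsilon> k \<le> \<mu> / 10"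
    using assms(11) unfolding VMiPG_def by blast
  have in_\<Gamma>: "x k \<in> \<Gamma>" "y k \<in> \<Gamma>" for k using assms(17) by auto
  note descent_step = VMiPG_step_descent[OF step _ par(2-5) \<open>L > 0\<close> \<open>L-lipschitz_on \<Gamma> (grad f)\<close>
      \<open>convex \<Gamma>\<close> \<open>\<Gamma> \<subseteq> Om\<close> in_\<Gamma>]
  have xD: "x k \<in> D" for k
    by (induction k) (auto intro: x0 descent_step(1))
  note inexact = VMiPG_step_inexact_minimizer[OF step xD]
  \<comment> \<open>The subproblem of iteration 0 supplies the affine minorant of g.\<close>
  have "\<exists>a b. \<forall>z\<in>D. a + b \<bullet> z \<le> gr z"
    using inexact(1,6)[of 0] model_min_imp_affine_minorant by blast
  then interpret forward_backward f g Om \<gamma>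
    using \<open>0 < \<gamma>\<close> by unfold_locales
  define d where "d k = norm (y k - x k)" for k
  define a where "a = \<sigma> * min 1 (\<beta> * ((\<mu> - 2 * \<sigma>) / L))"
  have "a > 0" using par \<open>L > 0\<close> by (simp add: a_def)
  have d_pos: "d k > 0" for k using inexact(4)[of k] by (simp add: d_def)
  have decrease: "a * (d k)\<^sup>2 \<le> objective (x k) - objective (x (Suc k))" for k
    using descent_step(4)[OF xD] by (simp add: a_def d_def)
  have strict: "objective (x (Suc k)) < objective (x k)" for k
    using decrease[of k] \<open>a > 0\<close> d_pos[of k] by (smt (verit) mult_pos_pos zero_less_power)
  obtain c where c: "ereal c < (INF u. f u + g u)"
    using assms(10) ereal_dense2 by blast
  have "c \<le> objective (x k)" for k
    using less_le_trans[OF c INF_lower[of "x k"]] by (simp add: objective_eq[OF xD])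
  moreover have "decseq (\<lambda>k. objective (x k))"
    using strict by (intro decseq_SucI less_imp_le)
  ultimately obtain Fs where Fs: "(\<lambda>k. objective (x k)) \<longlonglongrightarrow> Fs" "\<And>k. Fs \<le> objective (x k)"
    using decseq_convergent by metis
  have Fs_less: "Fs < objective (x k)" for k
    using Fs(2)[of "Suc k"] strict[of k] by linarith
  have d_lim: "d \<longlonglongrightarrow> 0"
    by (rule descent_imp_steps_vanish[OF decrease \<open>a > 0\<close> less_imp_le[OF d_pos] Fs(1)])
  have G_bound: "norm (G k h) \<le> \<mu>' * norm h" for k h
  proof -
    have "bounded_linear (G k)"
      using inexact(1)[of k] by (simp add: self_adjoint_def linear_conv_bounded_linear)
    then have "norm (G k h) \<le> onorm (G k) * norm h" by (rule onorm)
    also have "\<dots> \<le> \<mu>' * norm h" using assms(14) by (intro mult_right_mono) auto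
    finally show ?thesis .
  qed
  have "\<gamma> * \<mu>' \<le> 1" using \<open>\<gamma> \<le> 1 / \<mu>'\<close> \<open>\<mu>' > 0\<close> by (simp add: pos_le_divide_eq)
  have residual: "norm (x k - fb_step (x k)) \<le> 4 * d k"
    and upper_model: "fr (x k) + grad f (x k) \<bullet> (y k - x k) + gr (y k) \<le> env (x k)" if "k \<ge> kb" for k
  proof -
    obtain p where "model_min (G k) (x k) p"
      "model (G k) (x k) (y k) \<le> model (G k) (x k) p + \<epsilon> k * (norm (y k - x k))\<^sup>2"
      using inexact(6) by blast
    from inexact_minimizer_bounds[OF dom_subset(1)[OF xD] inexact(1) par(1) inexact(2) G_bound
        \<open>\<gamma> * \<mu>' \<le> 1\<close> this(1) inexact(3) this(2) kb[OF that]]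
    show "norm (x k - fb_step (x k)) \<le> 4 * d k"
      "fr (x k) + grad f (x k) \<bullet> (y k - x k) + gr (y k) \<le> env (x k)" by (simp_all add: d_def)
  qed
  \<comment> \<open>The value of the potential at (x k, y k, 0), caught between consecutive objective values up to a vanishing term.\<close>
  define h where "h k = env (x k) + L / 2 * (d k)\<^sup>2" for k
  have objective_le_h: "objective (x (Suc k)) \<le> h k" if "k \<ge> kb" for k
  proof -
    have "objective (x (Suc k)) \<le> objective (y k)" by (rule descent_step(2)[OF xD])
    also have "\<dots> \<le> h k"
      using descent[OF \<open>L-lipschitz_on \<Gamma> (grad f)\<close> \<open>convex \<Gamma>\<close> \<open>\<Gamma> \<subseteq> Om\<close> in_\<Gamma>, of k k]
        upper_model[OF that] by (simp add: objective_def h_def d_def)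
    finally show ?thesis .
  qed
  have h_lim: "h \<longlonglongrightarrow> Fs"
  proof (rule tendsto_sandwich[OF _ _ LIMSEQ_Suc[OF Fs(1)]])
    show "eventually (\<lambda>k. objective (x (Suc k)) \<le> h k) sequentially"
      using objective_le_h by (rule eventually_sequentiallyI)
    show "eventually (\<lambda>k. h k \<le> objective (x k) + L / 2 * (d k)\<^sup>2) sequentially"
      using env_le_objective[OF xD] by (simp add: h_def)
    have "(\<lambda>k. objective (x k) + L / 2 * (d k)\<^sup>2) \<longlonglongrightarrow> Fs + L / 2 * 0\<^sup>2"
      by (intro tendsto_intros Fs(1) d_lim)
    then show "(\<lambda>k. objective (x k) + L / 2 * (d k)\<^sup>2) \<longlonglongrightarrow> Fs" by simp
  qed
  obtain xb s where xb: "xb \<in> \<Gamma>" "strict_mono s" "(\<lambda>i. x (s i)) \<longlonglongrightarrow> xb"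
    using \<open>compact \<Gamma>\<close> in_\<Gamma>(1) unfolding compact_def o_def by metis
  have xb_cl: "xb \<in> closure D"
    unfolding closure_sequential by (intro exI[of _ "\<lambda>i. x (s i)"] conjI allI xD xb(3))
  have xb_Om: "xb \<in> Om" using xb(1) \<open>\<Gamma> \<subseteq> Om\<close> by blast
  \<comment> \<open>This centres the KL property at the cluster point at the limit of the objective values.\<close>
  have env_xb: "env xb = Fs"
  proof -
    have "(\<lambda>k. h k - L / 2 * (d k)\<^sup>2) \<longlonglongrightarrow> Fs - L / 2 * 0\<^sup>2"
      by (intro tendsto_intros h_lim d_lim)
    then have "(\<lambda>k. env (x k)) \<longlonglongrightarrow> Fs" by (simp add: h_def)
    from LIMSEQ_subseq_LIMSEQ[OF this xb(2)] have "(\<lambda>i. env (x (s i))) \<longlonglongrightarrow> Fs" by (simp add: o_def)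
    moreover have "(\<lambda>i. env (x (s i))) \<longlonglongrightarrow> env xb"
      using isCont_tendsto_compose[OF isCont_env[OF xb_Om] xb(3)] .
    ultimately show ?thesis using LIMSEQ_unique by blast
  qed
  have fixed: "fb_step xb = xb"
  proof -
    have "eventually (\<lambda>k. norm (x k - fb_step (x k)) \<le> 4 * d k) sequentially"
      using residual by (rule eventually_sequentiallyI)
    moreover have "(\<lambda>k. 4 * d k) \<longlonglongrightarrow> 0" using tendsto_mult_left[OF d_lim, of 4] by simp
    ultimately have "(\<lambda>k. x k - fb_step (x k)) \<longlonglongrightarrow> 0" by (rule Lim_null_comparison)
    from LIMSEQ_subseq_LIMSEQ[OF this xb(2)]
    have "(\<lambda>i. x (s i) - fb_step (x (s i))) \<longlonglongrightarrow> 0" by (simp add: o_def)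
    moreover have "(\<lambda>i. x (s i) - fb_step (x (s i))) \<longlonglongrightarrow> xb - fb_step xb"
      by (intro tendsto_diff xb(3) isCont_tendsto_compose[OF isCont_fb_step[OF xb_Om] xb(3)])
    ultimately have "xb - fb_step xb = 0" using LIMSEQ_unique by blast
    then show ?thesis by simp
  qed
  let ?\<Phi> = "Phi f g L \<gamma>" and ?zb = "(xb, xb, 0::real)"
  have Phi_z: "?\<Phi> (x k, y k, 0) = ereal (h k)" for k
    using fb_envelope_eq[OF dom_subset(2)[OF xD]] by (simp add: Phi_def h_def d_def)
  have Phi_zb: "?\<Phi> ?zb = ereal Fs"
    using fb_envelope_eq[OF xb_cl] by (simp add: Phi_def env_xb)
  have "limiting_subdiff ?\<Phi> ?zb \<noteq> {}"
    using Phi_regular_subgradient[OF xb_cl less_imp_le[OF \<open>L > 0\<close>], of xb 0]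
      regular_subdiff_subset_limiting by blast
  then have "KL_property_on Zspace ?\<Phi> ?zb"
    using assms(23) unfolding KL_function_on_def Zspace_def by simp
  then obtain \<delta> w \<phi> where KL: "\<delta> > 0" "w > 0" "\<phi> \<in> Upsilon w"
    "\<And>z. z \<in> Zspace \<Longrightarrow> norm (z - ?zb) \<le> \<delta> \<Longrightarrow> ?\<Phi> ?zb < ?\<Phi> z \<Longrightarrow> ?\<Phi> z < ?\<Phi> ?zb + w \<Longrightarrow>
       1 \<le> ereal (deriv \<phi> (real_of_ereal (?\<Phi> z - ?\<Phi> ?zb))) * dist_zero (limiting_subdiff ?\<Phi> z)"
    unfolding KL_property_on_def by blast
  obtain B where B: "\<And>k. norm (hess (x k)) \<le> B"
    using compact_imp_bounded[OF compact_continuous_image[OF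
        continuous_on_subset[OF hess(1) \<open>\<Gamma> \<subseteq> Om\<close>] \<open>compact \<Gamma>\<close>]] in_\<Gamma>(1)
    unfolding bounded_iff by blast
  have B_nonneg: "0 \<le> B" using B[of 0] norm_ge_zero[of "hess (x 0)"] by linarith
  let ?C = "4 * (B + 1 / \<gamma>) + 2 * L"
  have dist_le: "dist_zero (limiting_subdiff ?\<Phi> (x k, y k, 0)) \<le> ereal (?C * d k)" if "k \<ge> kb" for k
  proof -
    let ?v1 = "env_grad (x k) + L *\<^sub>R (x k - y k)" and ?v2 = "L *\<^sub>R (y k - x k)"
    have "norm (env_grad (x k)) \<le> (norm (hess (x k)) + 1 / \<gamma>) * norm (x k - fb_step (x k))"
      by (rule norm_env_grad_le)
    also have "\<dots> \<le> (B + 1 / \<gamma>) * (4 * d k)"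
      using B[of k] B_nonneg \<open>0 < \<gamma>\<close> residual[OF that] by (intro mult_mono) auto
    finally have "norm (env_grad (x k)) \<le> (B + 1 / \<gamma>) * (4 * d k)" .
    moreover have "norm (?v1, ?v2, 0::real) \<le> norm ?v1 + norm ?v2"
      using norm_Pair_le[of ?v1 "(?v2, 0::real)"] by simp
    moreover have "norm ?v1 \<le> norm (env_grad (x k)) + L * d k" "norm ?v2 = L * d k"
      using norm_triangle_ineq[of "env_grad (x k)" "L *\<^sub>R (x k - y k)"] \<open>L > 0\<close>
      by (simp_all add: d_def norm_minus_commute)
    ultimately have le: "norm (?v1, ?v2, 0::real) \<le> ?C * d k" by (simp add: algebra_simps)
    have "(?v1, ?v2, 0::real) \<in> limiting_subdiff ?\<Phi> (x k, y k, 0)"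
      using Phi_regular_subgradient[OF dom_subset(2)[OF xD] less_imp_le[OF \<open>L > 0\<close>], of k "y k" 0]
        regular_subdiff_subset_limiting by auto
    from dist_zero_le_norm[OF this] le show ?thesis by (rule order_trans[OF _ ereal_less_eq(3)[THEN iffD2]])
  qed
  \<comment> \<open>A third of the radius suffices: the norm of z - zb is at most 2 * norm (x k - xb) + d k.\<close>
  have "eventually (\<lambda>k. ereal (h k) < ereal Fs + w) sequentially"
  proof -
    have "ereal Fs < ereal Fs + w" using \<open>w > 0\<close> by (cases w) auto
    then show ?thesis using h_lim by (intro order_tendstoD(2)[of _ "ereal Fs"]) auto
  qed
  moreover have "eventually (\<lambda>k. d k < \<delta> / 3) sequentially"
    using d_lim \<open>\<delta> > 0\<close> by (intro order_tendstoD(2)) auto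
  moreover have "eventually (\<lambda>k. k \<ge> kb) sequentially" by (rule eventually_ge_at_top)
  ultimately have "eventually (\<lambda>k. ereal (h k) < ereal Fs + w \<and> d k < \<delta> / 3 \<and> k \<ge> kb) sequentially"
    by eventually_elim simp
  then obtain K0 where K0: "\<And>k. k \<ge> K0 \<Longrightarrow> ereal (h k) < ereal Fs + w \<and> d k < \<delta> / 3 \<and> k \<ge> kb"
    unfolding eventually_sequentially by blast
  \<comment> \<open>The gaps of the objective rather than those of the potential, which need not decrease.\<close>
  define r where "r k = objective (x k) - Fs" for k
  have KL_step: "ereal (r (Suc k)) < w \<and> 1 \<le> deriv \<phi> (r (Suc k)) * (?C * d k)"
    if k: "k \<ge> K0" and near: "norm (x k - xb) \<le> \<delta> / 3" for k
  proof -
    have K: "ereal (h k) < ereal Fs + w" "d k < \<delta> / 3" "k \<ge> kb" using K0[OF k] by auto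
    have r_le: "r (Suc k) \<le> h k - Fs" using objective_le_h[OF K(3)] by (simp add: r_def)
    have r_pos: "0 < r (Suc k)" using Fs_less by (simp add: r_def)
    have hw: "ereal (h k - Fs) < w" using K(1) by (cases w) auto
    have "norm ((x k, y k, 0) - ?zb) \<le> norm (x k - xb) + norm (y k - xb)"
      using norm_Pair_le[of "x k - xb" "(y k - xb, 0::real)"] by simp
    moreover have "norm (y k - xb) \<le> d k + norm (x k - xb)"
      using norm_triangle_ineq[of "y k - x k" "x k - xb"] by (simp add: d_def)
    ultimately have "norm ((x k, y k, 0) - ?zb) \<le> \<delta>" using near K(2) by linarith
    moreover have "(x k, y k, 0) \<in> Zspace" by (simp add: Zspace_def)
    moreover have "?\<Phi> ?zb < ?\<Phi> (x k, y k, 0)" using r_le r_pos by (simp add: Phi_z Phi_zb)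
    moreover have "?\<Phi> (x k, y k, 0) < ?\<Phi> ?zb + w" using K(1) by (simp add: Phi_z Phi_zb)
    ultimately have "1 \<le> ereal (deriv \<phi> (h k - Fs)) * dist_zero (limiting_subdiff ?\<Phi> (x k, y k, 0))"
      using KL(4)[of "(x k, y k, 0)"] by (simp add: Phi_z Phi_zb)
    also have "\<dots> \<le> ereal (deriv \<phi> (h k - Fs)) * ereal (?C * d k)"
    proof (intro ereal_mult_left_mono dist_le[OF K(3)])
      have "0 < deriv \<phi> (h k - Fs)" using KL(3) r_le r_pos hw by (auto simp: Upsilon_def)
      then show "0 \<le> ereal (deriv \<phi> (h k - Fs))" by simp
    qed
    finally have "1 \<le> deriv \<phi> (h k - Fs) * (?C * d k)" by simp
    also have "\<dots> \<le> deriv \<phi> (r (Suc k)) * (?C * d k)"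
    proof (intro mult_right_mono Upsilon_deriv_antimono[OF KL(3) r_pos r_le hw])
      show "0 \<le> ?C * d k" using B_nonneg \<open>0 < \<gamma>\<close> \<open>L > 0\<close> d_pos[of k] by simp
    qed
    finally have "1 \<le> deriv \<phi> (r (Suc k)) * (?C * d k)" .
    moreover have "ereal (r (Suc k)) < w" using hw r_le by (intro le_less_trans[OF _ hw]) simp
    ultimately show ?thesis by simp
  qed
  have r_pos: "0 < r k" for k using Fs_less by (simp add: r_def)
  have r_decrease: "a * (d k)\<^sup>2 \<le> r k - r (Suc k)" for k using decrease by (simp add: r_def)
  have r_lim: "r \<longlonglongrightarrow> 0" using tendsto_diff[OF Fs(1) tendsto_const[of Fs]] by (simp add: r_def[abs_def])
  have "\<delta> / 3 > 0" using \<open>\<delta> > 0\<close> by simp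
  have move: "norm (x (Suc k) - x k) \<le> d k" for k using descent_step(3)[OF xD] by (simp add: d_def)
  note conclusion = KL_descent_imp_finite_length[OF move r_decrease \<open>a > 0\<close> r_pos r_lim KL(3,2) xb(2,3)
      \<open>\<delta> / 3 > 0\<close> KL_step]
  show ?thesis
    using conclusion fb_step_fixed_point_stationary[OF xb_Om fixed] by blast
qed

end
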